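(* Let $\Phi$ be an invariant purely discrete random measure on $\mathbb R^d$ with finite intensity. Let $L$ be an invariant probability kernel from $\Omega\times\mathbb R^d$ to $\mathbb R^d$, and let $T$ be the random transport given by $T(\mathrm d(x,y)):=L(x,\mathrm dy)\,\Phi(\mathrm dx)$. Let $K$ be another invariant probability kernel from $\Omega\times\mathbb R^d$ to $\mathbb R^d$ satisfying $$\mathbb E[K_x\otimes K_y\mid T]=L_x\otimes L_y,\quad x,y\in\Phi,\ x\neq y,\ \mathbb P\text{-a.s.}$$ Assume that $\mathbb E^\Phi_0\Phi\{0\}<\infty$. Then $K\Phi$ is locally square-integrable if and only if $L\Phi$ is locally square-integrable. In this case, for every $W\in\mathcal K_0$, $$\lim_{r\to\infty}\lambda_d(rW)^{-1}\operatorname{Var}[K\Phi(rW)]=\lim_{r\to\infty}\lambda_d(rW)^{-1}\operatorname{Var}[L\Phi(rW)]$$ if one of the limits exists.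
   Context: $\lambda_d$ is Lebesgue measure and $\mathcal B^d$ the Borel $\sigma$-field on $\mathbb R^d$. $(\Omega,\mathcal A,\mathbb P)$ is a probability space, $(\Omega,\mathcal A)$ is a Borel space, and there is a measurable flow on $\Omega$: maps $\theta_x\colon\Omega\to\Omega$, $x\in\mathbb R^d$, with $(\omega,x)\mapsto\theta_x\omega$ measurable, $\theta_0=\mathrm{id}$, $\theta_x\circ\theta_y=\theta_{x+y}$, and $\mathbb P(\theta_xA)=\mathbb P(A)$ for all $x\in\mathbb R^d$, $A\in\mathcal A$. A random measure $\Phi$ on $\mathbb R^d$ is a random locally finite measure. It is invariant if $\Phi(\omega,B+x)=\Phi(\theta_x\omega,B)$ for all $\omega,x,B$, and locally square-integrable if $\mathbb E\Phi(B)^2<\infty$ for all bounded $B\in\mathcal B^d$. It is purely discrete if it can be written as $\Phi=\sum_{n\ge1}Y_n\delta_{X_n}$ with random $Y_n\ge0$ and $X_n\in\mathbb R^d$; $\Phi\{x\}:=\Phi(\{x\})$, and $x\in\Phi$ means $\Phi\{x\}>0$. The intensity $\gamma:=\mathbb E\Phi([0,1]^d)$ is assumed positive and finite. The Palm probability measure is $\mathbb P^\Phi_0(A):=\gamma^{-1}\mathbb E\int_{[0,1]^d}\mathbf 1_A(\theta_x)\,\Phi(\mathrm dx)$, with expectation $\mathbb E^\Phi_0$. A random transport is a random measure $T$ on $\mathbb R^d\times\mathbb R^d$ such that $T(\cdot\times\mathbb R^d)$ is locally finite. A probability kernel $K$ from $\Omega\times\mathbb R^d$ to $\mathbb R^d$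 is invariant if $K(\omega,x,B+x)=K(\theta_x\omega,0,B)$ for all $\omega,x,B$. Write $K_x=K(x)$ for the random probability measure $\omega\mapsto K(\omega,x,\cdot)$ and $K\Phi(\omega,\cdot):=\int K(\omega,x,\cdot)\,\Phi(\omega,\mathrm dx)$. In the conditional-expectation hypothesis, the points $x,y\in\Phi$ are the ($T$-measurably enumerated) atoms of $\Phi=T(\cdot\times\mathbb R^d)$, and conditional expectations of random measures are taken setwise. $\mathcal K_0$ is the set of convex bounded sets containing $0$ in their interior. *)

theory Defs
  imports "HOL-Probability.Probability"
begin

text \<open>A measurable space that is Borel isomorphic to a Borel subset of the unit interval.\<close>

definition borel_space :: "'w measure \<Rightarrow> bool" where
  "borel_space M \<longleftrightarrow>
     (\<exists>(S :: real set) f g. S \<in> sets borel \<and> S \<subseteq> {0..1} \<and>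
        f \<in> M \<rightarrow>\<^sub>M restrict_space borel S \<and> g \<in> restrict_space borel S \<rightarrow>\<^sub>M M \<and>
        (\<forall>\<omega>\<in>space M. g (f \<omega>) = \<omega>) \<and> (\<forall>s\<in>S. f (g s) = s))"

text \<open>The flow is written \<open>\<theta> x \<omega>\<close>; every set \<open>\<theta> x ` A\<close> below is measurable,
  being the preimage of \<open>A\<close> under \<open>\<theta> (- x)\<close>.\<close>

locale stationary_flow = prob_space M
  for M :: "'w measure" and \<theta> :: "'a::euclidean_space \<Rightarrow> 'w \<Rightarrow> 'w" +
  assumes borel_space: "borel_space M"
    and flow_measurable: "(\<lambda>(\<omega>, x). \<theta> x \<omega>) \<in> M \<Otimes>\<^sub>M borel \<rightarrow>\<^sub>M M"
    and flow_zero: "\<And>\<omega>. \<omega> \<in> space M \<Longrightarrow> \<theta> 0 \<omega> = \<omega>"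
    and flow_add: "\<And>x y \<omega>. \<omega> \<in> space M \<Longrightarrow> \<theta> x (\<theta> y \<omega>) = \<theta> (x + y) \<omega>"
    and flow_invariant: "\<And>x A. A \<in> sets M \<Longrightarrow> prob (\<theta> x ` A) = prob A"

definition random_measure :: "'w measure \<Rightarrow> ('w \<Rightarrow> 'b::euclidean_space measure) \<Rightarrow> bool" where
  "random_measure M \<Phi> \<longleftrightarrow>
     (\<forall>\<omega>\<in>space M. sets (\<Phi> \<omega>) = sets borel) \<and>
     (\<forall>\<omega>\<in>space M. \<forall>B\<in>sets borel. bounded B \<longrightarrow> emeasure (\<Phi> \<omega>) B < \<infinity>) \<and>
     (\<forall>B\<in>sets borel. (\<lambda>\<omega>. emeasure (\<Phi> \<omega>) B) \<in> borel_measurable M)"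

definition invariant_measure ::
  "'w measure \<Rightarrow> ('a::euclidean_space \<Rightarrow> 'w \<Rightarrow> 'w) \<Rightarrow> ('w \<Rightarrow> 'a measure) \<Rightarrow> bool" where
  "invariant_measure M \<theta> \<Phi> \<longleftrightarrow>
     (\<forall>\<omega>\<in>space M. \<forall>x. \<forall>B\<in>sets borel.
        emeasure (\<Phi> \<omega>) ((\<lambda>b. b + x) ` B) = emeasure (\<Phi> (\<theta> x \<omega>)) B)"

definition purely_discrete :: "'w measure \<Rightarrow> ('w \<Rightarrow> 'a::euclidean_space measure) \<Rightarrow> bool" where
  "purely_discrete M \<Phi> \<longleftrightarrow>
     (\<exists>(Y :: nat \<Rightarrow> 'w \<Rightarrow> real) (X :: nat \<Rightarrow> 'w \<Rightarrow> 'a).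
        (\<forall>n. Y n \<in> borel_measurable M \<and> X n \<in> borel_measurable M) \<and>
        (\<forall>n. \<forall>\<omega>\<in>space M. 0 \<le> Y n \<omega>) \<and>
        (\<forall>\<omega>\<in>space M. \<forall>B\<in>sets borel.
           emeasure (\<Phi> \<omega>) B = (\<Sum>n. ennreal (Y n \<omega>) * indicator B (X n \<omega>))))"

definition locally_square_integrable ::
  "'w measure \<Rightarrow> ('w \<Rightarrow> 'a::euclidean_space measure) \<Rightarrow> bool" where
  "locally_square_integrable M \<Phi> \<longleftrightarrow>
     (\<forall>B\<in>sets borel. bounded B \<longrightarrow> (\<integral>\<^sup>+\<omega>. (emeasure (\<Phi> \<omega>) B)\<^sup>2 \<partial>M) < \<infinity>)"

definition atoms :: "'a::euclidean_space measure \<Rightarrow> 'a set" where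
  "atoms \<mu> = {x. emeasure \<mu> {x} > 0}"

definition intensity :: "'w measure \<Rightarrow> ('w \<Rightarrow> 'a::euclidean_space measure) \<Rightarrow> ennreal" where
  "intensity M \<Phi> = (\<integral>\<^sup>+\<omega>. emeasure (\<Phi> \<omega>) (cbox 0 One) \<partial>M)"

definition palm_measure ::
  "'w measure \<Rightarrow> ('a::euclidean_space \<Rightarrow> 'w \<Rightarrow> 'w) \<Rightarrow> ('w \<Rightarrow> 'a measure) \<Rightarrow> 'w measure" where
  "palm_measure M \<theta> \<Phi> = measure_of (space M) (sets M)
     (\<lambda>A. (\<integral>\<^sup>+\<omega>. (\<integral>\<^sup>+x\<in>cbox 0 One. indicator A (\<theta> x \<omega>) \<partial>\<Phi> \<omega>) \<partial>M) / intensity M \<Phi>)"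

definition probability_kernel ::
  "'w measure \<Rightarrow> ('w \<Rightarrow> 'a::euclidean_space \<Rightarrow> 'a measure) \<Rightarrow> bool" where
  "probability_kernel M K \<longleftrightarrow> (\<lambda>(\<omega>, x). K \<omega> x) \<in> M \<Otimes>\<^sub>M borel \<rightarrow>\<^sub>M prob_algebra borel"

definition invariant_kernel ::
  "'w measure \<Rightarrow> ('a::euclidean_space \<Rightarrow> 'w \<Rightarrow> 'w) \<Rightarrow> ('w \<Rightarrow> 'a \<Rightarrow> 'a measure) \<Rightarrow> bool" where
  "invariant_kernel M \<theta> K \<longleftrightarrow>
     (\<forall>\<omega>\<in>space M. \<forall>x. \<forall>B\<in>sets borel.
        emeasure (K \<omega> x) ((\<lambda>b. b + x) ` B) = emeasure (K (\<theta> x \<omega>) 0) B)"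

text \<open>The Giry \<open>bind\<close> is also correct for the possibly infinite measure \<open>\<Phi> \<omega>\<close>,
  only the kernel has to be subprobabilistic; see \<open>emeasure_kernel_image\<close> and
  \<open>emeasure_transport\<close> below.\<close>

definition kernel_image ::
  "('w \<Rightarrow> 'a::euclidean_space \<Rightarrow> 'a measure) \<Rightarrow> ('w \<Rightarrow> 'a measure) \<Rightarrow> 'w \<Rightarrow> 'a measure" where
  "kernel_image K \<Phi> \<omega> = \<Phi> \<omega> \<bind> K \<omega>"

definition transport ::
  "('w \<Rightarrow> 'a::euclidean_space \<Rightarrow> 'a measure) \<Rightarrow> ('w \<Rightarrow> 'a measure) \<Rightarrow> 'w \<Rightarrow> ('a \<times> 'a) measure" where
  "transport L \<Phi> \<omega> = \<Phi> \<omega> \<bind> (\<lambda>x. distr (L \<omega> x) borel (\<lambda>y. (x, y)))"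

lemma probability_kernel_section:
  assumes "probability_kernel M K" "\<omega> \<in> space M"
  shows "K \<omega> \<in> borel \<rightarrow>\<^sub>M prob_algebra borel"
proof -
  have "(\<lambda>x. (\<lambda>(\<omega>, x). K \<omega> x) (\<omega>, x)) \<in> borel \<rightarrow>\<^sub>M prob_algebra borel"
    by (rule measurable_compose[OF measurable_Pair1'[OF assms(2)]
          assms(1)[unfolded probability_kernel_def]])
  then show ?thesis by simp
qed

lemma emeasure_kernel_image:
  assumes "random_measure M \<Phi>" "probability_kernel M K" "\<omega> \<in> space M" "B \<in> sets borel"
  shows "emeasure (kernel_image K \<Phi> \<omega>) B = (\<integral>\<^sup>+x. emeasure (K \<omega> x) B \<partial>\<Phi> \<omega>)"
proof -
  have s: "sets (\<Phi> \<omega>) = sets borel"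
    using assms by (auto simp: random_measure_def)
  have "K \<omega> \<in> \<Phi> \<omega> \<rightarrow>\<^sub>M subprob_algebra borel"
    using measurable_prob_algebraD[OF probability_kernel_section[OF assms(2,3)]]
    by (simp add: measurable_cong_sets[OF s refl])
  then show ?thesis
    unfolding kernel_image_def
    using sets_eq_imp_space_eq[OF s] assms(4) by (subst emeasure_bind) auto
qed

lemma emeasure_transport:
  assumes "random_measure M \<Phi>" "probability_kernel M L" "\<omega> \<in> space M" "C \<in> sets borel"
  shows "emeasure (transport L \<Phi> \<omega>) C = (\<integral>\<^sup>+x. emeasure (L \<omega> x) {y. (x, y) \<in> C} \<partial>\<Phi> \<omega>)"
proof -
  have s: "sets (\<Phi> \<omega>) = sets borel"
    using assms by (auto simp: random_measure_def)
  have L: "L \<omega> \<in> borel \<rightarrow>\<^sub>M subprob_algebra borel"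
    by (rule measurable_prob_algebraD[OF probability_kernel_section[OF assms(2,3)]])
  have "(\<lambda>x. distr (L \<omega> x) borel (\<lambda>y. (x, y))) \<in> borel \<rightarrow>\<^sub>M subprob_algebra borel"
    by (rule measurable_distr2[OF _ L]) (simp add: borel_prod)
  then have k: "(\<lambda>x. distr (L \<omega> x) borel (\<lambda>y. (x, y))) \<in> \<Phi> \<omega> \<rightarrow>\<^sub>M subprob_algebra borel"
    by (simp add: measurable_cong_sets[OF s refl])
  have "emeasure (transport L \<Phi> \<omega>) C
      = (\<integral>\<^sup>+x. emeasure (distr (L \<omega> x) borel (\<lambda>y. (x, y))) C \<partial>\<Phi> \<omega>)"
    unfolding transport_def
    using sets_eq_imp_space_eq[OF s] k assms(4) by (subst emeasure_bind) auto
  also have "\<dots> = (\<integral>\<^sup>+x. emeasure (L \<omega> x) {y. (x, y) \<in> C} \<partial>\<Phi> \<omega>)"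
  proof (rule nn_integral_cong)
    fix x
    have b: "sets (L \<omega> x) = sets borel"
      using measurable_space[OF L, of x] by (simp add: space_subprob_algebra)
    have "(\<lambda>y. (x, y)) \<in> L \<omega> x \<rightarrow>\<^sub>M borel"
      by (simp add: measurable_cong_sets[OF b refl])
    then show "emeasure (distr (L \<omega> x) borel (\<lambda>y. (x, y))) C = emeasure (L \<omega> x) {y. (x, y) \<in> C}"
      using assms(4) sets_eq_imp_space_eq[OF b] by (simp add: emeasure_distr vimage_def)
  qed
  finally show ?thesis .
qed

text \<open>The \<open>\<sigma>\<close>-field on \<open>space M\<close> generated by the random measure \<open>T\<close>.\<close>

definition sigma_of :: "'w measure \<Rightarrow> ('w \<Rightarrow> 'b::euclidean_space measure) \<Rightarrow> 'w measure" where
  "sigma_of M T = sigma (space M)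
     {(\<lambda>\<omega>. emeasure (T \<omega>) C) -` U \<inter> space M | C U. C \<in> sets borel \<and> U \<in> sets borel}"

text \<open>The atoms of \<open>\<Phi> \<omega>\<close> are enumerated by a \<open>T\<close>-measurable sequence \<open>X\<close>.  Since there may be only
  finitely many atoms, the sequence may repeat atoms and contain points that are not atoms;
  the condition is only imposed on the (\<open>T\<close>-measurable) event that the two
  enumerated points are distinct atoms.\<close>

definition cond_product_kernel ::
  "'w measure \<Rightarrow> ('w \<Rightarrow> 'a::euclidean_space measure) \<Rightarrow> ('w \<Rightarrow> ('a \<times> 'a) measure) \<Rightarrow>
   ('w \<Rightarrow> 'a \<Rightarrow> 'a measure) \<Rightarrow> ('w \<Rightarrow> 'a \<Rightarrow> 'a measure) \<Rightarrow> bool" where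
  "cond_product_kernel M \<Phi> T K L \<longleftrightarrow>
     (\<exists>X :: nat \<Rightarrow> 'w \<Rightarrow> 'a.
        (\<forall>n. X n \<in> borel_measurable (sigma_of M T)) \<and>
        (\<forall>\<omega>\<in>space M. atoms (\<Phi> \<omega>) \<subseteq> range (\<lambda>n. X n \<omega>)) \<and>
        (\<forall>m n. \<forall>C\<in>sets (borel \<Otimes>\<^sub>M borel). AE \<omega> in M.
           X m \<omega> \<in> atoms (\<Phi> \<omega>) \<and> X n \<omega> \<in> atoms (\<Phi> \<omega>) \<and> X m \<omega> \<noteq> X n \<omega> \<longrightarrow>
           real_cond_exp M (sigma_of M T)
             (\<lambda>\<omega>. measure (K \<omega> (X m \<omega>) \<Otimes>\<^sub>M K \<omega> (X n \<omega>)) C) \<omega> =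
           measure (L \<omega> (X m \<omega>) \<Otimes>\<^sub>M L \<omega> (X n \<omega>)) C))"

definition \<K>\<^sub>0 :: "'a::euclidean_space set set" where
  "\<K>\<^sub>0 = {W. convex W \<and> bounded W \<and> 0 \<in> interior W}"

text \<open>\<open>\<lambda>\<^sub>d(rW)\<inverse> Var[\<Xi>(rW)]\<close>.  A set in \<open>\<K>\<^sub>0\<close> need not be Borel; for a non-Borel \<open>W\<close>, where \<open>\<Xi>(rW)\<close>
  is not defined, the library's default values make this quotient \<open>0\<close>.\<close>

definition normalized_variance ::
  "'w measure \<Rightarrow> ('w \<Rightarrow> 'a::euclidean_space measure) \<Rightarrow> 'a set \<Rightarrow> real \<Rightarrow> real" where
  "normalized_variance M \<Xi> W r =
     prob_space.variance M (\<lambda>\<omega>. measure (\<Xi> \<omega>) ((\<lambda>x. r *\<^sub>R x) ` W)) /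
     measure lborel ((\<lambda>x. r *\<^sub>R x) ` W)"

end

theory Submission
  imports Defs
begin

text \<open>
  Writing \<open>K\<Phi>(B)\<close> as a sum over the atoms of \<open>\<Phi>\<close> splits its second moment into a sum over pairs of
  distinct atoms and the diagonal \<open>\<bbbE> \<integral> \<Phi>{x} K\<^sub>x(B)\<^sup>2 \<Phi>(dx)\<close>.  The weights \<open>\<Phi>{x} \<Phi>{y}\<close> are functions of \<open>T\<close>, so
  the conditional expectation hypothesis makes the off-diagonal parts for \<open>K\<close> and \<open>L\<close> equal, whether
  finite or not.  By the refined Campbell theorem the diagonal equals
  \<open>\<gamma> \<integral> \<bbbE>\<^sub>0[\<Phi>{0} K\<^sub>0(B - z)\<^sup>2] dz\<close>, which is at most \<open>\<gamma> \<bbbE>\<^sub>0[\<Phi>{0}] \<lambda>(B)\<close> and hence finite.  Substituting \<open>z = ru\<close>, the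
  diagonal for \<open>B = rW\<close> divided by \<open>\<lambda>(rW)\<close> tends to \<open>\<gamma> \<bbbE>\<^sub>0[\<Phi>{0}]\<close>: this is the upper bound above, and
  Fatou's lemma gives the lower bound since \<open>K\<^sub>0(r(W - u)) \<rightarrow> 1\<close> for \<open>u\<close> in the interior of \<open>W\<close>.  The limit is
  the same for \<open>K\<close> and \<open>L\<close>, and so are the means, so the difference of the normalized variances vanishes
  asymptotically.\<close>

section \<open>Purely discrete stationary random measures\<close>

locale stationary_point_masses = stationary_flow M \<theta>
  for M :: "'w measure" and \<theta> :: "'a::euclidean_space \<Rightarrow> 'w \<Rightarrow> 'w" +
  fixes \<Phi> :: "'w \<Rightarrow> 'a measure" and Y :: "nat \<Rightarrow> 'w \<Rightarrow> real" and X :: "nat \<Rightarrow> 'w \<Rightarrow> 'a"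
  assumes random: "random_measure M \<Phi>"
    and invariant: "invariant_measure M \<theta> \<Phi>"
    and Y_measurable[measurable]: "\<And>n. Y n \<in> borel_measurable M"
    and X_measurable[measurable]: "\<And>n. X n \<in> borel_measurable M"
    and Y_nonneg: "\<And>n \<omega>. \<omega> \<in> space M \<Longrightarrow> 0 \<le> Y n \<omega>"
    and intensity_pos: "0 < intensity M \<Phi>"
    and intensity_finite: "intensity M \<Phi> < \<infinity>"
    and emeasure_\<Phi>: "\<And>\<omega> B. \<omega> \<in> space M \<Longrightarrow> B \<in> sets borel \<Longrightarrow>
      emeasure (\<Phi> \<omega>) B = (\<Sum>n. ennreal (Y n \<omega>) * indicator B (X n \<omega>))"
begin

lemma sets_\<Phi>: "\<omega> \<in> space M \<Longrightarrow> sets (\<Phi> \<omega>) = sets borel"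
  using random by (auto simp: random_measure_def)

lemma space_\<Phi>: "\<omega> \<in> space M \<Longrightarrow> space (\<Phi> \<omega>) = UNIV"
  using sets_eq_imp_space_eq[OF sets_\<Phi>] by simp

lemma emeasure_\<Phi>_finite:
  "\<omega> \<in> space M \<Longrightarrow> B \<in> sets borel \<Longrightarrow> bounded B \<Longrightarrow> emeasure (\<Phi> \<omega>) B < \<infinity>"
  using random by (auto simp: random_measure_def)

text \<open>As the image of a weighted counting measure on the indices,
  \<open>\<Phi> \<omega>\<close> turns integrals into series over \<open>n\<close>. Measurability in
  \<omega> and Tonelli's theorem are then obtained termwise.\<close>

lemma \<Phi>_eq_distr:
  assumes "\<omega> \<in> space M"
  shows "\<Phi> \<omega> = distr (density (count_space UNIV) (\<lambda>n. ennreal (Y n \<omega>))) borel (\<lambda>n. X n \<omega>)"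
proof (rule measure_eqI)
  fix B assume "B \<in> sets (\<Phi> \<omega>)"
  then have B: "B \<in> sets borel"
    using sets_\<Phi>[OF assms] by simp
  show "emeasure (\<Phi> \<omega>) B =
      emeasure (distr (density (count_space UNIV) (\<lambda>n. ennreal (Y n \<omega>))) borel (\<lambda>n. X n \<omega>)) B"
    using B assms
    by (simp add: emeasure_\<Phi> emeasure_distr emeasure_density nn_integral_count_space_nat indicator_def)
qed (simp add: sets_\<Phi>[OF assms])

lemma nn_integral_\<Phi>:
  assumes \<omega>: "\<omega> \<in> space M" and f: "f \<in> borel_measurable borel"
  shows "(\<integral>\<^sup>+x. f x \<partial>\<Phi> \<omega>) = (\<Sum>n. ennreal (Y n \<omega>) * f (X n \<omega>))"
  unfolding \<Phi>_eq_distr[OF \<omega>] using f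
  by (simp add: nn_integral_distr nn_integral_density nn_integral_count_space_nat)

lemma measurable_nn_integral_\<Phi>:
  assumes [measurable]: "case_prod f \<in> borel_measurable (M \<Otimes>\<^sub>M borel)"
  shows "(\<lambda>\<omega>. \<integral>\<^sup>+x. f \<omega> x \<partial>\<Phi> \<omega>) \<in> borel_measurable M"
proof -
  have "(\<lambda>\<omega>. \<Sum>n. ennreal (Y n \<omega>) * f \<omega> (X n \<omega>)) \<in> borel_measurable M"
    by measurable
  then show ?thesis
    by (subst measurable_cong[OF nn_integral_\<Phi>]) auto
qed

section \<open>Invariance of the probability and of \<Phi> under the flow\<close>

lemma flow_measurable2[measurable (raw)]:
  assumes [measurable]: "f \<in> N \<rightarrow>\<^sub>M M" "g \<in> N \<rightarrow>\<^sub>M borel"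
  shows "(\<lambda>s. \<theta> (g s) (f s)) \<in> N \<rightarrow>\<^sub>M M"
  using measurable_compose[OF _ flow_measurable, of "\<lambda>s. (f s, g s)" N] by simp

lemma flow_space: "\<omega> \<in> space M \<Longrightarrow> \<theta> x \<omega> \<in> space M"
  using measurable_space[OF flow_measurable, of "(\<omega>, x)"] by (simp add: space_pair_measure)

text \<open>\<open>\<theta> x\<close> is a bijection of \<open>space M\<close> with inverse
  \<open>\<theta> (- x)\<close>. This links the invariance assumption, stated for images, with
  \<open>distr\<close>, which uses preimages.\<close>

lemma flow_image:
  assumes "A \<in> sets M" shows "\<theta> x ` A = \<theta> (- x) -` A \<inter> space M"
proof -
  have "\<theta> x \<omega> \<in> \<theta> (- x) -` A \<inter> space M" if "\<omega> \<in> A" for \<omega>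
    using that sets.sets_into_space[OF assms] by (auto simp: flow_space flow_add flow_zero subset_iff)
  moreover have "\<omega> \<in> \<theta> x ` A" if "\<theta> (- x) \<omega> \<in> A" "\<omega> \<in> space M" for \<omega>
    using that by (intro image_eqI[of _ _ "\<theta> (- x) \<omega>"]) (auto simp: flow_add flow_zero)
  ultimately show ?thesis by blast
qed

lemma distr_flow: "distr M M (\<theta> x) = M"
proof (rule measure_eqI)
  fix A assume "A \<in> sets (distr M M (\<theta> x))"
  then have A: "A \<in> sets M" by simp
  have "emeasure M (\<theta> x -` A \<inter> space M) = emeasure M A"
    using flow_invariant[OF A, of "- x"] flow_image[OF A, of "- x"] by (simp add: emeasure_eq_measure)
  then show "emeasure (distr M M (\<theta> x)) A = emeasure M A"
    using A by (simp add: emeasure_distr)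
qed simp

lemma nn_integral_flow:
  assumes "f \<in> borel_measurable M"
  shows "(\<integral>\<^sup>+\<omega>. f (\<theta> x \<omega>) \<partial>M) = (\<integral>\<^sup>+\<omega>. f \<omega> \<partial>M)"
  using nn_integral_distr[of "\<theta> x" M M f] assms by (simp add: distr_flow)

text \<open>B + y is the preimage of B under x \<mapsto> x - y, so applying
  \<open>\<theta> y\<close> to the sample point moves every atom by -y.\<close>

lemma \<Phi>_flow:
  assumes \<omega>: "\<omega> \<in> space M"
  shows "\<Phi> (\<theta> y \<omega>) = distr (\<Phi> \<omega>) borel (\<lambda>x. x - y)"
proof (rule measure_eqI)
  fix B assume "B \<in> sets (\<Phi> (\<theta> y \<omega>))"
  then have B: "B \<in> sets borel"
    using sets_\<Phi>[OF flow_space[OF \<omega>]] by simp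
  have "(\<lambda>x. x - y) -` B = (\<lambda>b. b + y) ` B"
    by (auto intro!: image_eqI[where x="_ - y"])
  moreover have "(\<lambda>x. x - y) \<in> \<Phi> \<omega> \<rightarrow>\<^sub>M borel"
    by (simp add: measurable_cong_sets[OF sets_\<Phi>[OF \<omega>] refl])
  ultimately show "emeasure (\<Phi> (\<theta> y \<omega>)) B = emeasure (distr (\<Phi> \<omega>) borel (\<lambda>x. x - y)) B"
    using B invariant \<omega> by (simp add: emeasure_distr space_\<Phi> invariant_measure_def)
qed (simp add: sets_\<Phi>[OF flow_space[OF \<omega>]])

lemma nn_integral_\<Phi>_flow:
  assumes \<omega>: "\<omega> \<in> space M" and f: "f \<in> borel_measurable borel"
  shows "(\<integral>\<^sup>+x. f x \<partial>\<Phi> (\<theta> y \<omega>)) = (\<integral>\<^sup>+x. f (x - y) \<partial>\<Phi> \<omega>)"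
  unfolding \<Phi>_flow[OF \<omega>]
  by (rule nn_integral_distr) (use f in \<open>simp_all add: measurable_cong_sets[OF sets_\<Phi>[OF \<omega>] refl]\<close>)

text \<open>Replacing \<omega> by \<open>\<theta> y \<omega>\<close> preserves the probability and
  moves an atom x to x - y. Since
  \<open>\<theta> (x - y) (\<theta> y \<omega>) = \<theta> x \<omega>\<close>, only the second
  argument of \<open>h\<close> feels the shift.\<close>

lemma nn_integral_\<Phi>_shift:
  assumes [measurable]: "case_prod h \<in> borel_measurable (M \<Otimes>\<^sub>M borel)"
  shows "(\<integral>\<^sup>+\<omega>. \<integral>\<^sup>+x. h (\<theta> x \<omega>) (x - y) \<partial>\<Phi> \<omega> \<partial>M) = (\<integral>\<^sup>+\<omega>. \<integral>\<^sup>+x. h (\<theta> x \<omega>) x \<partial>\<Phi> \<omega> \<partial>M)"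
proof -
  have "(\<integral>\<^sup>+\<omega>. \<integral>\<^sup>+x. h (\<theta> x \<omega>) x \<partial>\<Phi> \<omega> \<partial>M)
      = (\<integral>\<^sup>+\<omega>. \<integral>\<^sup>+x. h (\<theta> x (\<theta> y \<omega>)) x \<partial>\<Phi> (\<theta> y \<omega>) \<partial>M)"
    by (rule nn_integral_flow[symmetric]) (rule measurable_nn_integral_\<Phi>, measurable)
  also have "\<dots> = (\<integral>\<^sup>+\<omega>. \<integral>\<^sup>+x. h (\<theta> x \<omega>) (x - y) \<partial>\<Phi> \<omega> \<partial>M)"
  proof (rule nn_integral_cong)
    fix \<omega> assume \<omega>[measurable]: "\<omega> \<in> space M"
    have "(\<lambda>x. h (\<theta> x (\<theta> y \<omega>)) x) \<in> borel_measurable borel"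
      using flow_space[OF \<omega>, measurable] by measurable
    then show "(\<integral>\<^sup>+x. h (\<theta> x (\<theta> y \<omega>)) x \<partial>\<Phi> (\<theta> y \<omega>)) = (\<integral>\<^sup>+x. h (\<theta> x \<omega>) (x - y) \<partial>\<Phi> \<omega>)"
      using \<omega> by (subst nn_integral_\<Phi>_flow) (auto simp: flow_add)
  qed
  finally show ?thesis ..
qed

text \<open>The inner measure varies with \<omega>. Its series representation leaves an exchange of
  sum and integral, and Tonelli's theorem for the fixed measures \<open>M\<close> and
  \<open>N\<close>.\<close>

lemma nn_integral_\<Phi>_fubini:
  assumes N: "sigma_finite_measure N"
    and [measurable]: "(\<lambda>(\<omega>, x, z). f \<omega> x z) \<in> borel_measurable (M \<Otimes>\<^sub>M borel \<Otimes>\<^sub>M N)"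
  shows "(\<integral>\<^sup>+\<omega>. \<integral>\<^sup>+x. \<integral>\<^sup>+z. f \<omega> x z \<partial>N \<partial>\<Phi> \<omega> \<partial>M) = (\<integral>\<^sup>+z. \<integral>\<^sup>+\<omega>. \<integral>\<^sup>+x. f \<omega> x z \<partial>\<Phi> \<omega> \<partial>M \<partial>N)"
proof -
  interpret N: sigma_finite_measure N by fact
  interpret P: pair_sigma_finite M N ..
  have "(\<integral>\<^sup>+\<omega>. \<integral>\<^sup>+x. \<integral>\<^sup>+z. f \<omega> x z \<partial>N \<partial>\<Phi> \<omega> \<partial>M)
      = (\<integral>\<^sup>+\<omega>. (\<Sum>n. ennreal (Y n \<omega>) * (\<integral>\<^sup>+z. f \<omega> (X n \<omega>) z \<partial>N)) \<partial>M)"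
    by (intro nn_integral_cong nn_integral_\<Phi>) (auto intro: N.borel_measurable_nn_integral)
  also have "\<dots> = (\<integral>\<^sup>+\<omega>. \<integral>\<^sup>+z. (\<Sum>n. ennreal (Y n \<omega>) * f \<omega> (X n \<omega>) z) \<partial>N \<partial>M)"
    by (intro nn_integral_cong) (simp add: nn_integral_suminf nn_integral_cmult)
  also have "\<dots> = (\<integral>\<^sup>+z. \<integral>\<^sup>+\<omega>. (\<Sum>n. ennreal (Y n \<omega>) * f \<omega> (X n \<omega>) z) \<partial>M \<partial>N)"
  proof (rule P.Fubini'[symmetric])
    have [measurable]: "(\<lambda>p. f (fst p) (X n (fst p)) (snd p)) \<in> borel_measurable (M \<Otimes>\<^sub>M N)" for n
      using measurable_compose[OF _ assms(2), of "\<lambda>p. (fst p, X n (fst p), snd p)"] by simp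
    show "(\<lambda>(\<omega>, z). \<Sum>n. ennreal (Y n \<omega>) * f \<omega> (X n \<omega>) z) \<in> borel_measurable (M \<Otimes>\<^sub>M N)"
      by measurable
  qed
  also have "\<dots> = (\<integral>\<^sup>+z. \<integral>\<^sup>+\<omega>. \<integral>\<^sup>+x. f \<omega> x z \<partial>\<Phi> \<omega> \<partial>M \<partial>N)"
    by (intro nn_integral_cong nn_integral_\<Phi>[symmetric]) measurable
  finally show ?thesis .
qed

lemma measurable_nn_integral_\<Phi>2[measurable (raw)]:
  assumes [measurable]: "(\<lambda>(z, \<omega>, x). f z \<omega> x) \<in> borel_measurable (N \<Otimes>\<^sub>M M \<Otimes>\<^sub>M borel)"
  shows "(\<lambda>z. \<integral>\<^sup>+\<omega>. \<integral>\<^sup>+x. f z \<omega> x \<partial>\<Phi> \<omega> \<partial>M) \<in> borel_measurable N"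
proof -
  have [measurable]: "(\<lambda>p. f (fst p) (snd p) (X n (snd p))) \<in> borel_measurable (N \<Otimes>\<^sub>M M)" for n
    using measurable_compose[OF _ assms, of "\<lambda>p. (fst p, snd p, X n (snd p))"] by simp
  have "(\<lambda>z. \<integral>\<^sup>+\<omega>. (\<Sum>n. ennreal (Y n \<omega>) * f z \<omega> (X n \<omega>)) \<partial>M) \<in> borel_measurable N"
    by measurable
  moreover have "(\<integral>\<^sup>+\<omega>. \<integral>\<^sup>+x. f z \<omega> x \<partial>\<Phi> \<omega> \<partial>M)
      = (\<integral>\<^sup>+\<omega>. (\<Sum>n. ennreal (Y n \<omega>) * f z \<omega> (X n \<omega>)) \<partial>M)" if [measurable]: "z \<in> space N" for z
    by (intro nn_integral_cong nn_integral_\<Phi>) measurable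
  ultimately show ?thesis
    by (simp cong: measurable_cong)
qed

abbreviation unit_cube :: "'a set" where
  "unit_cube \<equiv> cbox 0 One"

lemma emeasure_lborel_unit_cube: "emeasure lborel unit_cube = 1"
  by (simp add: emeasure_lborel_cbox_eq inner_sum_left inner_Basis)

text \<open>Averaging over all shifts \<open>y\<close> in the unit cube turns the refined Campbell theorem into an
  instance of Tonelli's theorem.\<close>

lemma campbell_unit_cube:
  assumes [measurable]: "case_prod h \<in> borel_measurable (M \<Otimes>\<^sub>M borel)"
  shows "(\<integral>\<^sup>+\<omega>. \<integral>\<^sup>+x. h (\<theta> x \<omega>) x \<partial>\<Phi> \<omega> \<partial>M)
    = (\<integral>\<^sup>+z. \<integral>\<^sup>+\<omega>. \<integral>\<^sup>+x. indicator unit_cube x * h (\<theta> x \<omega>) z \<partial>\<Phi> \<omega> \<partial>M \<partial>lborel)"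
proof -
  have "(\<integral>\<^sup>+\<omega>. \<integral>\<^sup>+x. h (\<theta> x \<omega>) x \<partial>\<Phi> \<omega> \<partial>M)
      = (\<integral>\<^sup>+y. indicator unit_cube y * (\<integral>\<^sup>+\<omega>. \<integral>\<^sup>+x. h (\<theta> x \<omega>) x \<partial>\<Phi> \<omega> \<partial>M) \<partial>lborel)"
    by (simp add: nn_integral_multc emeasure_lborel_unit_cube)
  also have "\<dots> = (\<integral>\<^sup>+y. \<integral>\<^sup>+\<omega>. \<integral>\<^sup>+x. indicator unit_cube y * h (\<theta> x \<omega>) (x - y) \<partial>\<Phi> \<omega> \<partial>M \<partial>lborel)"
    by (rule nn_integral_cong) (auto simp: nn_integral_\<Phi>_shift[of h, symmetric] indicator_def)
  also have "\<dots> = (\<integral>\<^sup>+\<omega>. \<integral>\<^sup>+x. \<integral>\<^sup>+y. indicator unit_cube y * h (\<theta> x \<omega>) (x - y) \<partial>lborel \<partial>\<Phi> \<omega> \<partial>M)"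
    by (rule nn_integral_\<Phi>_fubini[symmetric]) (auto intro: sigma_finite_lborel)
  \<comment> \<open>Substitution z = x - y, a reflection whose Jacobian factor is 1.\<close>
  also have "\<dots> = (\<integral>\<^sup>+\<omega>. \<integral>\<^sup>+x. \<integral>\<^sup>+z. indicator unit_cube (x - z) * h (\<theta> x \<omega>) z \<partial>lborel \<partial>\<Phi> \<omega> \<partial>M)"
  proof (rule nn_integral_cong, rule nn_integral_cong)
    fix \<omega> x assume \<omega>[measurable]: "\<omega> \<in> space M"
    have [measurable]: "\<theta> x \<omega> \<in> space M"
      using \<omega> by (rule flow_space)
    have "(\<integral>\<^sup>+z. indicator unit_cube (x - z) * h (\<theta> x \<omega>) z \<partial>lborel)
        = (\<integral>\<^sup>+z. indicator unit_cube (x - z) * h (\<theta> x \<omega>) z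
            \<partial>density (distr lborel borel (\<lambda>y. x + (- 1) *\<^sub>R y)) (\<lambda>_. ennreal (\<bar>- 1\<bar> ^ DIM('a))))"
      by (subst lborel_affine[of "- 1" x, symmetric]) auto
    also have "\<dots> = (\<integral>\<^sup>+y. indicator unit_cube y * h (\<theta> x \<omega>) (x - y) \<partial>lborel)"
      by (subst nn_integral_density) (auto simp: nn_integral_distr)
    finally show "(\<integral>\<^sup>+y. indicator unit_cube y * h (\<theta> x \<omega>) (x - y) \<partial>lborel)
        = (\<integral>\<^sup>+z. indicator unit_cube (x - z) * h (\<theta> x \<omega>) z \<partial>lborel)" ..
  qed
  also have "\<dots> = (\<integral>\<^sup>+z. \<integral>\<^sup>+\<omega>. \<integral>\<^sup>+x. indicator unit_cube (x - z) * h (\<theta> x \<omega>) z \<partial>\<Phi> \<omega> \<partial>M \<partial>lborel)"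
    by (rule nn_integral_\<Phi>_fubini) (auto intro: sigma_finite_lborel)
  \<comment> \<open>A second shift, by z for each fixed z, moves the window back to the unit cube;
    the first argument of \<open>h\<close> is not affected.\<close>
  also have "\<dots> = (\<integral>\<^sup>+z. \<integral>\<^sup>+\<omega>. \<integral>\<^sup>+x. indicator unit_cube x * h (\<theta> x \<omega>) z \<partial>\<Phi> \<omega> \<partial>M \<partial>lborel)"
    by (intro nn_integral_cong nn_integral_\<Phi>_shift[where h="\<lambda>\<omega> x. indicator unit_cube x * h \<omega> _"])
       measurable
  finally show ?thesis .
qed

end

section \<open>Kernels, Palm measure and the refined Campbell theorem\<close>

locale prob_kernel =
  fixes M :: "'w measure" and K :: "'w \<Rightarrow> 'a::euclidean_space \<Rightarrow> 'a measure"
  assumes kernel: "probability_kernel M K"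
begin

lemma kernel_measurable[measurable (raw)]:
  assumes [measurable]: "f \<in> N \<rightarrow>\<^sub>M M" "g \<in> N \<rightarrow>\<^sub>M borel"
  shows "(\<lambda>s. K (f s) (g s)) \<in> N \<rightarrow>\<^sub>M subprob_algebra borel"
  using measurable_compose[OF _ measurable_prob_algebraD[OF kernel[unfolded probability_kernel_def]],
      of "\<lambda>s. (f s, g s)" N] by simp

lemma kernel_in_prob_algebra: "\<omega> \<in> space M \<Longrightarrow> K \<omega> x \<in> space (prob_algebra borel)"
  using measurable_space[OF kernel[unfolded probability_kernel_def], of "(\<omega>, x)"]
  by (simp add: space_pair_measure)

lemma prob_space_kernel: "\<omega> \<in> space M \<Longrightarrow> prob_space (K \<omega> x)"
  using kernel_in_prob_algebra by (simp add: space_prob_algebra)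

lemma sets_kernel: "\<omega> \<in> space M \<Longrightarrow> sets (K \<omega> x) = sets borel"
  using kernel_in_prob_algebra by (simp add: space_prob_algebra)

lemma space_kernel: "\<omega> \<in> space M \<Longrightarrow> space (K \<omega> x) = UNIV"
  using sets_eq_imp_space_eq[OF sets_kernel] by simp

lemma emeasure_kernel_le_1: "\<omega> \<in> space M \<Longrightarrow> emeasure (K \<omega> x) B \<le> 1"
  by (rule prob_space.measure_le_1[OF prob_space_kernel])

lemma measurable_emeasure_kernel[measurable (raw)]:
  assumes [measurable]: "f \<in> N \<rightarrow>\<^sub>M M" "g \<in> N \<rightarrow>\<^sub>M borel"
    and P[measurable]: "Measurable.pred (N \<Otimes>\<^sub>M borel) (\<lambda>p. P (fst p) (snd p))"
  shows "(\<lambda>s. emeasure (K (f s) (g s)) {y. P s y}) \<in> borel_measurable N"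
proof (rule emeasure_measurable_subprob_algebra2)
  have "(SIGMA s:space N. {y. P s y}) = {p \<in> space (N \<Otimes>\<^sub>M borel). P (fst p) (snd p)}"
    by (auto simp: space_pair_measure)
  also have "\<dots> \<in> sets (N \<Otimes>\<^sub>M borel)"
    by measurable
  finally show "(SIGMA s:space N. {y. P s y}) \<in> sets (N \<Otimes>\<^sub>M borel)" .
qed measurable

lemma measurable_emeasure_kernel_const[measurable (raw)]:
  assumes [measurable]: "f \<in> N \<rightarrow>\<^sub>M M" "g \<in> N \<rightarrow>\<^sub>M borel" "B \<in> sets borel"
  shows "(\<lambda>s. emeasure (K (f s) (g s)) B) \<in> borel_measurable N"
  using measurable_emeasure_kernel[of f N g "\<lambda>_ y. y \<in> B"] by simp

text \<open>Convolving a probability measure with Lebesgue measure gives Lebesgue measure: after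
  Tonelli, the section at a fixed y is the translate B - y.\<close>

lemma nn_integral_emeasure_kernel_translate:
  assumes \<omega>: "\<omega> \<in> space M" and B[measurable]: "B \<in> sets borel"
  shows "(\<integral>\<^sup>+z. emeasure (K \<omega> x) {y. y + z \<in> B} \<partial>lborel) = emeasure lborel B"
proof -
  interpret K: prob_space "K \<omega> x"
    using \<omega> by (rule prob_space_kernel)
  note [measurable_cong] = sets_kernel[OF \<omega>]
  interpret P: pair_sigma_finite "K \<omega> x" lborel ..
  have "(\<integral>\<^sup>+z. emeasure (K \<omega> x) {y. y + z \<in> B} \<partial>lborel)
      = (\<integral>\<^sup>+z. \<integral>\<^sup>+y. indicator B (y + z) \<partial>K \<omega> x \<partial>lborel)"
  proof (rule nn_integral_cong)
    fix z
    have "{y. y + z \<in> B} \<in> sets (K \<omega> x)"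
      unfolding sets_kernel[OF \<omega>] by measurable
    then have "emeasure (K \<omega> x) {y. y + z \<in> B} = (\<integral>\<^sup>+y. indicator {y. y + z \<in> B} y \<partial>K \<omega> x)"
      by simp
    then show "emeasure (K \<omega> x) {y. y + z \<in> B} = (\<integral>\<^sup>+y. indicator B (y + z) \<partial>K \<omega> x)"
      by (simp add: indicator_def)
  qed
  also have "\<dots> = (\<integral>\<^sup>+y. \<integral>\<^sup>+z. indicator B (y + z) \<partial>lborel \<partial>K \<omega> x)"
    by (rule P.Fubini') measurable
  also have "\<dots> = (\<integral>\<^sup>+y. emeasure lborel B \<partial>K \<omega> x)"
  proof (rule nn_integral_cong)
    fix y :: 'a
    have "(\<integral>\<^sup>+z. indicator B (y + z) \<partial>lborel) = (\<integral>\<^sup>+z. indicator B z \<partial>distr lborel borel ((+) y))"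
      by (simp add: nn_integral_distr del: nn_integral_indicator)
    then show "(\<integral>\<^sup>+z. indicator B (y + z) \<partial>lborel) = emeasure lborel B"
      by (simp add: lborel_distr_plus)
  qed
  finally show ?thesis
    by (simp add: K.emeasure_space_1)
qed

text \<open>For an interior point \<open>u\<close> of \<open>W\<close> the sets \<open>r\<^sub>n(W - u)\<close> eventually contain every point.\<close>

lemma emeasure_kernel_scaled_tendsto_1:
  assumes \<omega>: "\<omega> \<in> space M" and W[measurable]: "W \<in> sets borel" and u: "u \<in> interior W"
    and r: "filterlim r at_top sequentially"
  shows "(\<lambda>n. emeasure (K \<omega> x) {y. inverse (r n) *\<^sub>R y + u \<in> W}) \<longlonglongrightarrow> 1"
proof -
  interpret K: prob_space "K \<omega> x"
    using \<omega> by (rule prob_space_kernel)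
  note [measurable_cong] = sets_kernel[OF \<omega>]
  have "(\<lambda>n. inverse (r n) *\<^sub>R y + u) \<longlonglongrightarrow> 0 *\<^sub>R y + u" for y
    by (intro tendsto_intros tendsto_inverse_0_at_top r)
  then have ev: "eventually (\<lambda>n. inverse (r n) *\<^sub>R y + u \<in> W) sequentially" for y
    using topological_tendstoD[of _ u sequentially "interior W"] u interior_subset[of W]
    by (force elim: eventually_mono)
  have "(\<lambda>n. \<integral>\<^sup>+y. indicator W (inverse (r n) *\<^sub>R y + u) \<partial>K \<omega> x) \<longlonglongrightarrow> (\<integral>\<^sup>+y. 1 \<partial>K \<omega> x)"
    by (rule nn_integral_dominated_convergence[where w="\<lambda>_. 1"])
      (use ev in \<open>auto simp: K.emeasure_space_1 indicator_def intro!: tendsto_eventually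
        elim: eventually_mono\<close>)
  moreover have "(\<integral>\<^sup>+y. indicator W (inverse (r n) *\<^sub>R y + u) \<partial>K \<omega> x)
      = emeasure (K \<omega> x) {y. inverse (r n) *\<^sub>R y + u \<in> W}" for n
  proof -
    have "{y. inverse (r n) *\<^sub>R y + u \<in> W} \<in> sets (K \<omega> x)"
      unfolding sets_kernel[OF \<omega>] by measurable
    then have "emeasure (K \<omega> x) {y. inverse (r n) *\<^sub>R y + u \<in> W}
        = (\<integral>\<^sup>+y. indicator {y. inverse (r n) *\<^sub>R y + u \<in> W} y \<partial>K \<omega> x)"
      by simp
    then show ?thesis
      by (simp add: indicator_def)
  qed
  ultimately show ?thesis
    by (simp add: K.emeasure_space_1)
qed

end

section \<open>The Palm probability measure and Campbell's theorem\<close>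

context stationary_point_masses
begin

abbreviation "palm \<equiv> palm_measure M \<theta> \<Phi>"

abbreviation "\<gamma> \<equiv> intensity M \<Phi>"

lemma sets_palm[simp, measurable_cong]: "sets palm = sets M"
  by (simp add: palm_measure_def)

lemma space_palm[simp]: "space palm = space M"
  by (simp add: palm_measure_def)

text \<open>\<open>palm_measure\<close> is built by \<open>measure_of\<close>, which keeps the given
  set function only if that is a measure. Hence a measure \<open>Q\<close> is constructed first, as
  an image of a weighted product of counting measure and \<open>M\<close>, and its values are
  matched with the set function.\<close>

lemma nn_integral_palm:
  assumes g[measurable]: "g \<in> borel_measurable M"
  shows "(\<integral>\<^sup>+\<omega>. g \<omega> \<partial>palm)
    = (\<integral>\<^sup>+\<omega>. \<integral>\<^sup>+x. indicator unit_cube x * g (\<theta> x \<omega>) \<partial>\<Phi> \<omega> \<partial>M) / \<gamma>"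
proof -
  let ?N = "count_space (UNIV :: nat set) \<Otimes>\<^sub>M M"
  \<comment> \<open>The weight is the mass at index \<open>n\<close> if \<open>X n\<close> lies in
    the unit cube, divided by \<gamma>. The map used in \<open>Q\<close> sends an index and \<omega>
    to the sample point seen from \<open>X n\<close>.\<close>
  define w where "w = (\<lambda>(n, \<omega>). ennreal (Y n \<omega>) * indicator unit_cube (X n \<omega>) / \<gamma>)"
  have w[measurable]: "w \<in> borel_measurable ?N"
    unfolding w_def by (rule measurable_pair_measure_countable1) auto
  have t[measurable]: "(\<lambda>(n, \<omega>). \<theta> (X n \<omega>) \<omega>) \<in> ?N \<rightarrow>\<^sub>M M"
    by (rule measurable_pair_measure_countable1) auto
  define Q where "Q = distr (density ?N w) M (\<lambda>(n, \<omega>). \<theta> (X n \<omega>) \<omega>)"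
  have int_Q: "(\<integral>\<^sup>+\<omega>. f \<omega> \<partial>Q)
      = (\<integral>\<^sup>+\<omega>. \<integral>\<^sup>+x. indicator unit_cube x * f (\<theta> x \<omega>) \<partial>\<Phi> \<omega> \<partial>M) / \<gamma>"
    if [measurable]: "f \<in> borel_measurable M" for f
  proof -
    have "(\<integral>\<^sup>+\<omega>. f \<omega> \<partial>Q) = (\<integral>\<^sup>+p. w p * f (\<theta> (X (fst p) (snd p)) (snd p)) \<partial>?N)"
      using t unfolding Q_def
      by (subst nn_integral_distr, simp, simp, subst nn_integral_density) (auto simp: split_beta')
    also have "\<dots> = (\<Sum>n. \<integral>\<^sup>+\<omega>. w (n, \<omega>) * f (\<theta> (X n \<omega>) \<omega>) \<partial>M)"
      using t by (subst nn_integral_fst[symmetric])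
        (auto simp: nn_integral_count_space_nat split_beta')
    also have "\<dots> = (\<integral>\<^sup>+\<omega>. (\<Sum>n. w (n, \<omega>) * f (\<theta> (X n \<omega>) \<omega>)) \<partial>M)"
      by (rule nn_integral_suminf[symmetric]) (auto simp: w_def)
    also have "\<dots> = (\<integral>\<^sup>+\<omega>. (\<integral>\<^sup>+x. indicator unit_cube x * f (\<theta> x \<omega>) \<partial>\<Phi> \<omega>) / \<gamma> \<partial>M)"
    proof (rule nn_integral_cong)
      fix \<omega> assume [measurable]: "\<omega> \<in> space M"
      have "(\<integral>\<^sup>+x. indicator unit_cube x * f (\<theta> x \<omega>) \<partial>\<Phi> \<omega>)
          = (\<Sum>n. ennreal (Y n \<omega>) * (indicator unit_cube (X n \<omega>) * f (\<theta> (X n \<omega>) \<omega>)))"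
        by (rule nn_integral_\<Phi>) measurable
      then show "(\<Sum>n. w (n, \<omega>) * f (\<theta> (X n \<omega>) \<omega>))
          = (\<integral>\<^sup>+x. indicator unit_cube x * f (\<theta> x \<omega>) \<partial>\<Phi> \<omega>) / \<gamma>"
        by (simp add: w_def divide_ennreal_def ennreal_suminf_cmult[symmetric] mult_ac)
    qed
    also have "\<dots> = (\<integral>\<^sup>+\<omega>. \<integral>\<^sup>+x. indicator unit_cube x * f (\<theta> x \<omega>) \<partial>\<Phi> \<omega> \<partial>M) / \<gamma>"
      by (rule nn_integral_divide) (rule measurable_nn_integral_\<Phi>, measurable)
    finally show ?thesis .
  qed
  have "palm = measure_of (space M) (sets M) (emeasure Q)"
    unfolding palm_measure_def
  proof (rule measure_of_eq)
    show "sets M \<subseteq> Pow (space M)"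
      by (rule sets.space_closed)
  next
    fix A assume A: "A \<in> sigma_sets (space M) (sets M)"
    then have A[measurable]: "A \<in> sets M"
      by (simp add: sets.sigma_sets_eq)
    have "emeasure Q A = (\<integral>\<^sup>+\<omega>. indicator A \<omega> \<partial>Q)"
      using A by (simp add: Q_def)
    then show "(\<integral>\<^sup>+\<omega>. \<integral>\<^sup>+x. indicator A (\<theta> x \<omega>) * indicator unit_cube x \<partial>\<Phi> \<omega> \<partial>M) / \<gamma>
        = emeasure Q A"
      using int_Q[of "indicator A"] by (simp add: mult.commute)
  qed
  moreover have "measure_of (space M) (sets M) (emeasure Q) = Q"
    using measure_of_of_measure[of Q] by (simp add: Q_def)
  ultimately show ?thesis
    using int_Q[OF g] by simp
qed

lemma prob_space_palm: "prob_space palm"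
proof
  have "emeasure palm (space palm) = (\<integral>\<^sup>+\<omega>. 1 \<partial>palm)"
    by simp
  also have "\<dots> = (\<integral>\<^sup>+\<omega>. emeasure (\<Phi> \<omega>) unit_cube \<partial>M) / \<gamma>"
    by (subst nn_integral_palm)
      (auto intro!: arg_cong2[where f=divide] nn_integral_cong nn_integral_indicator simp: sets_\<Phi>)
  also have "\<dots> = 1"
    using intensity_pos intensity_finite by (simp add: intensity_def)
  finally show "emeasure palm (space palm) = 1" .
qed

text \<open>For fixed z, the inner integral over the unit cube in \<open>campbell_unit_cube\<close>
  is \<gamma> times a Palm expectation; 0 < \<gamma> < \<infinity> allows the normalisation to be
  cancelled.\<close>

theorem refined_campbell:
  assumes [measurable]: "case_prod h \<in> borel_measurable (M \<Otimes>\<^sub>M borel)"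
  shows "(\<integral>\<^sup>+\<omega>. \<integral>\<^sup>+x. h (\<theta> x \<omega>) x \<partial>\<Phi> \<omega> \<partial>M) = \<gamma> * (\<integral>\<^sup>+z. \<integral>\<^sup>+\<omega>. h \<omega> z \<partial>palm \<partial>lborel)"
proof -
  interpret palm: prob_space palm
    by (rule prob_space_palm)
  have "(\<integral>\<^sup>+\<omega>. \<integral>\<^sup>+x. indicator unit_cube x * h (\<theta> x \<omega>) z \<partial>\<Phi> \<omega> \<partial>M) = \<gamma> * (\<integral>\<^sup>+\<omega>. h \<omega> z \<partial>palm)" for z
    using intensity_pos intensity_finite
    by (simp add: nn_integral_palm ennreal_times_divide ennreal_mult_divide_eq mult.commute[of \<gamma>])
  then show ?thesis
    by (simp add: campbell_unit_cube nn_integral_cmult)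
qed

end

section \<open>Asymptotics of the diagonal\<close>

lemma nn_integral_lborel_scaleR:
  fixes f :: "'a::euclidean_space \<Rightarrow> ennreal"
  assumes [measurable]: "f \<in> borel_measurable borel" and r: "r > 0"
  shows "(\<integral>\<^sup>+z. f z \<partial>lborel) = ennreal (r ^ DIM('a)) * (\<integral>\<^sup>+u. f (r *\<^sub>R u) \<partial>lborel)"
proof -
  have "(\<integral>\<^sup>+z. f z \<partial>lborel)
      = (\<integral>\<^sup>+z. f z \<partial>density (distr lborel borel (\<lambda>u. 0 + r *\<^sub>R u)) (\<lambda>_. ennreal (\<bar>r\<bar> ^ DIM('a))))"
    using r by (subst lborel_affine[of r 0, symmetric]) auto
  then show ?thesis
    using r by (simp add: nn_integral_density nn_integral_distr nn_integral_cmult)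
qed

lemma borel_scaleR_image:
  fixes W :: "'a::euclidean_space set"
  assumes [measurable]: "W \<in> sets borel" and r: "r > 0"
  shows "(\<lambda>x. r *\<^sub>R x) ` W \<in> sets borel"
proof -
  have "(\<lambda>x. r *\<^sub>R x) ` W = (\<lambda>x. inverse r *\<^sub>R x) -` W \<inter> space borel"
    using r by (auto intro!: image_eqI[where x="inverse r *\<^sub>R _"])
  moreover have "(\<lambda>x. inverse r *\<^sub>R x) -` W \<inter> space borel \<in> sets borel"
    by (rule measurable_sets[of _ borel borel]) simp_all
  ultimately show ?thesis
    by (rule ssubst)
qed

lemma borel_scaleR_image_iff:
  fixes W :: "'a::euclidean_space set"
  assumes r: "r > 0"
  shows "(\<lambda>x. r *\<^sub>R x) ` W \<in> sets borel \<longleftrightarrow> W \<in> sets borel"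
proof
  assume "(\<lambda>x. r *\<^sub>R x) ` W \<in> sets borel"
  then have "(\<lambda>x. inverse r *\<^sub>R x) ` (\<lambda>x. r *\<^sub>R x) ` W \<in> sets borel"
    by (rule borel_scaleR_image) (use r in simp)
  also have "(\<lambda>x. inverse r *\<^sub>R x) ` (\<lambda>x. r *\<^sub>R x) ` W = (\<lambda>x. x) ` W"
    unfolding image_image using r by (intro image_cong) auto
  finally show "W \<in> sets borel"
    by simp
qed (use r in \<open>auto intro: borel_scaleR_image\<close>)

lemma emeasure_lborel_scaleR_image:
  fixes W :: "'a::euclidean_space set"
  assumes W: "W \<in> sets borel" and r: "r > 0"
  shows "emeasure lborel ((\<lambda>x. r *\<^sub>R x) ` W) = ennreal (r ^ DIM('a)) * emeasure lborel W"
proof -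
  have "emeasure lborel ((\<lambda>x. r *\<^sub>R x) ` W)
      = ennreal (r ^ DIM('a)) * (\<integral>\<^sup>+u. indicator ((\<lambda>x. r *\<^sub>R x) ` W) (r *\<^sub>R u) \<partial>lborel)"
    using borel_scaleR_image[OF W r] r
    by (simp add: nn_integral_lborel_scaleR[symmetric])
  also have "(\<integral>\<^sup>+u. indicator ((\<lambda>x. r *\<^sub>R x) ` W) (r *\<^sub>R u) \<partial>lborel) = (\<integral>\<^sup>+u. indicator W u \<partial>lborel)"
    using r by (intro nn_integral_cong) (auto simp: indicator_def)
  finally show ?thesis
    using W by simp
qed

text \<open>The boundary of a convex set is a Lebesgue null set. The interior matters because the
  pointwise convergence in the Fatou argument is available only there.\<close>

lemma emeasure_lborel_interior_convex:
  fixes W :: "'a::euclidean_space set"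
  assumes W: "W \<in> sets borel" and c: "convex W"
  shows "emeasure lborel (interior W) = emeasure lborel W"
proof -
  have f: "frontier W \<in> null_sets lborel"
    using negligible_convex_frontier[OF c] by (simp add: negligible_iff_null_sets null_sets_completion_iff)
  have "emeasure lborel W = emeasure lborel (interior W \<union> (W - interior W))"
    using interior_subset by (metis Un_Diff_cancel sup.absorb_iff2)
  also have "W - interior W \<in> null_sets lborel"
    using W by (intro null_sets_subset[OF f]) (auto simp: frontier_def closure_subset[THEN subsetD])
  then have "emeasure lborel (interior W \<union> (W - interior W)) = emeasure lborel (interior W)"
    by (intro emeasure_Un_null_set) auto
  finally show ?thesis ..
qed

section \<open>Mass transported by an invariant kernel\<close>

locale stationary_transport = stationary_point_masses M \<theta> \<Phi> Y X + prob_kernel M K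
  for M :: "'w measure" and \<theta> :: "'a::euclidean_space \<Rightarrow> 'w \<Rightarrow> 'w"
    and \<Phi> :: "'w \<Rightarrow> 'a measure" and Y :: "nat \<Rightarrow> 'w \<Rightarrow> real" and X :: "nat \<Rightarrow> 'w \<Rightarrow> 'a"
    and K :: "'w \<Rightarrow> 'a \<Rightarrow> 'a measure" +
  assumes kernel_invariant: "invariant_kernel M \<theta> K"
    and palm_mass_finite: "(\<integral>\<^sup>+\<omega>. emeasure (\<Phi> \<omega>) {0} \<partial>palm_measure M \<theta> \<Phi>) < \<infinity>"
begin

text \<open>The singleton moves with \<open>s\<close>; the series representation replaces it by the
  events \<open>X n (f s) = g s\<close>.\<close>

lemma measurable_point_mass[measurable (raw)]:
  assumes [measurable]: "f \<in> N \<rightarrow>\<^sub>M M" "g \<in> borel_measurable N"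
  shows "(\<lambda>s. emeasure (\<Phi> (f s)) {g s}) \<in> borel_measurable N"
proof -
  have "(\<lambda>s. \<Sum>n. ennreal (Y n (f s)) * (if X n (f s) = g s then 1 else 0)) \<in> borel_measurable N"
    by measurable
  moreover have "emeasure (\<Phi> (f s)) {g s} = (\<Sum>n. ennreal (Y n (f s)) * (if X n (f s) = g s then 1 else 0))"
    if "s \<in> space N" for s
    using measurable_space[OF assms(1) that] by (simp add: emeasure_\<Phi> indicator_def of_bool_def)
  ultimately show ?thesis
    by (simp cong: measurable_cong)
qed

lemma point_mass_flow: "\<omega> \<in> space M \<Longrightarrow> emeasure (\<Phi> (\<theta> x \<omega>)) {0} = emeasure (\<Phi> \<omega>) {x}"
  using invariant[unfolded invariant_measure_def, rule_format, of \<omega> "{0}" x] by simp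

text \<open>Brings K_x(B) into the form \<open>h (\<theta> x \<omega>) x\<close> required by
  Campbell's theorem; the set on the left is B - x.\<close>

lemma kernel_flow:
  assumes "\<omega> \<in> space M" and [measurable]: "B \<in> sets borel"
  shows "emeasure (K (\<theta> x \<omega>) 0) {y. y + x \<in> B} = emeasure (K \<omega> x) B"
proof -
  have "{y. y + x \<in> B} \<in> sets borel"
    by measurable
  moreover have "(\<lambda>b. b + x) ` {y. y + x \<in> B} = B"
    by (auto intro!: image_eqI[where x="_ - x"])
  ultimately show ?thesis
    using kernel_invariant[unfolded invariant_kernel_def, rule_format, OF assms(1), of "{y. y + x \<in> B}" x]
    by simp
qed

text \<open>Campbell's theorem for the product of \<open>g\<close> and K_0(B - z), followed by
  Tonelli: integrating over z first yields the volume of B. The choice g = 1 gives the mean of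
  K\<Phi>(B), and g = \<Phi>{0} bounds the diagonal.\<close>

theorem transported_mass:
  assumes g[measurable]: "g \<in> borel_measurable M" and B[measurable]: "B \<in> sets borel"
  shows "(\<integral>\<^sup>+\<omega>. \<integral>\<^sup>+x. g (\<theta> x \<omega>) * emeasure (K \<omega> x) B \<partial>\<Phi> \<omega> \<partial>M)
    = \<gamma> * ((\<integral>\<^sup>+\<omega>. g \<omega> \<partial>palm) * emeasure lborel B)"
proof -
  interpret palm: prob_space palm
    by (rule prob_space_palm)
  interpret P: pair_sigma_finite palm lborel ..
  have "(\<integral>\<^sup>+\<omega>. \<integral>\<^sup>+x. g (\<theta> x \<omega>) * emeasure (K \<omega> x) B \<partial>\<Phi> \<omega> \<partial>M)
      = (\<integral>\<^sup>+\<omega>. \<integral>\<^sup>+x. g (\<theta> x \<omega>) * emeasure (K (\<theta> x \<omega>) 0) {y. y + x \<in> B} \<partial>\<Phi> \<omega> \<partial>M)"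
    by (intro nn_integral_cong) (simp add: kernel_flow)
  also have "\<dots> = \<gamma> * (\<integral>\<^sup>+z. \<integral>\<^sup>+\<omega>. g \<omega> * emeasure (K \<omega> 0) {y. y + z \<in> B} \<partial>palm \<partial>lborel)"
    by (rule refined_campbell) measurable
  also have "(\<integral>\<^sup>+z. \<integral>\<^sup>+\<omega>. g \<omega> * emeasure (K \<omega> 0) {y. y + z \<in> B} \<partial>palm \<partial>lborel)
      = (\<integral>\<^sup>+\<omega>. \<integral>\<^sup>+z. g \<omega> * emeasure (K \<omega> 0) {y. y + z \<in> B} \<partial>lborel \<partial>palm)"
    by (rule P.Fubini') measurable
  also have "\<dots> = (\<integral>\<^sup>+\<omega>. g \<omega> * emeasure lborel B \<partial>palm)"
    by (intro nn_integral_cong)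
      (simp add: nn_integral_cmult nn_integral_emeasure_kernel_translate)
  finally show ?thesis
    by (simp add: nn_integral_multc)
qed

section \<open>The diagonal part of the second moment and its scaling limit\<close>

definition diagonal :: "'a set \<Rightarrow> ennreal" where
  "diagonal B = (\<integral>\<^sup>+\<omega>. \<integral>\<^sup>+x. emeasure (\<Phi> \<omega>) {x} * (emeasure (K \<omega> x) B)\<^sup>2 \<partial>\<Phi> \<omega> \<partial>M)"

text \<open>A number in [0,1] dominates its square, so \<open>transported_mass\<close> applies with
  \<open>g\<close> the mass at 0.\<close>

lemma diagonal_le:
  assumes [measurable]: "B \<in> sets borel"
  shows "diagonal B \<le> \<gamma> * ((\<integral>\<^sup>+\<omega>. emeasure (\<Phi> \<omega>) {0} \<partial>palm) * emeasure lborel B)"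
proof -
  have "diagonal B \<le> (\<integral>\<^sup>+\<omega>. \<integral>\<^sup>+x. emeasure (\<Phi> (\<theta> x \<omega>)) {0} * emeasure (K \<omega> x) B \<partial>\<Phi> \<omega> \<partial>M)"
    unfolding diagonal_def
  proof (rule nn_integral_mono, rule nn_integral_mono)
    fix \<omega> x assume \<omega>: "\<omega> \<in> space M"
    have "emeasure (K \<omega> x) B * emeasure (K \<omega> x) B \<le> emeasure (K \<omega> x) B * 1"
      by (intro mult_left_mono emeasure_kernel_le_1 \<omega>) simp
    then show "emeasure (\<Phi> \<omega>) {x} * (emeasure (K \<omega> x) B)\<^sup>2
        \<le> emeasure (\<Phi> (\<theta> x \<omega>)) {0} * emeasure (K \<omega> x) B"
      using \<omega> by (auto simp: point_mass_flow power2_eq_square intro: mult_left_mono)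
  qed
  also have "\<dots> = \<gamma> * ((\<integral>\<^sup>+\<omega>. emeasure (\<Phi> \<omega>) {0} \<partial>palm) * emeasure lborel B)"
    by (rule transported_mass) measurable
  finally show ?thesis .
qed

lemma diagonal_finite:
  assumes "B \<in> sets borel" "bounded B"
  shows "diagonal B < \<infinity>"
  using diagonal_le[OF assms(1)] intensity_finite palm_mass_finite emeasure_bounded_finite[OF assms(2)]
  by (auto simp: ennreal_mult_less_top intro!: le_less_trans[OF diagonal_le[OF assms(1)]])

lemma diagonal_palm:
  assumes [measurable]: "B \<in> sets borel"
  shows "diagonal B
    = \<gamma> * (\<integral>\<^sup>+z. \<integral>\<^sup>+\<omega>. emeasure (\<Phi> \<omega>) {0} * (emeasure (K \<omega> 0) {y. y + z \<in> B})\<^sup>2 \<partial>palm \<partial>lborel)"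
proof -
  have "diagonal B = (\<integral>\<^sup>+\<omega>. \<integral>\<^sup>+x. emeasure (\<Phi> (\<theta> x \<omega>)) {0}
      * (emeasure (K (\<theta> x \<omega>) 0) {y. y + x \<in> B})\<^sup>2 \<partial>\<Phi> \<omega> \<partial>M)"
    unfolding diagonal_def by (intro nn_integral_cong) (simp add: kernel_flow point_mass_flow)
  also have "\<dots> = \<gamma> * (\<integral>\<^sup>+z. \<integral>\<^sup>+\<omega>. emeasure (\<Phi> \<omega>) {0}
      * (emeasure (K \<omega> 0) {y. y + z \<in> B})\<^sup>2 \<partial>palm \<partial>lborel)"
    by (rule refined_campbell[where h="\<lambda>\<omega> x. emeasure (\<Phi> \<omega>) {0} * (emeasure (K \<omega> 0) {y. y + x \<in> B})\<^sup>2"])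
      measurable
  finally show ?thesis .
qed

text \<open>The diagonal of rW after the substitution z = ru, with the factors \<gamma> and r^d
  removed.\<close>

definition scaled_diagonal :: "'a set \<Rightarrow> real \<Rightarrow> ennreal" where
  "scaled_diagonal W r = (\<integral>\<^sup>+u. \<integral>\<^sup>+\<omega>. emeasure (\<Phi> \<omega>) {0}
    * (emeasure (K \<omega> 0) {y. inverse r *\<^sub>R y + u \<in> W})\<^sup>2 \<partial>palm \<partial>lborel)"

lemma diagonal_scaleR_image:
  assumes W[measurable]: "W \<in> sets borel" and r: "r > 0"
  shows "diagonal ((\<lambda>x. r *\<^sub>R x) ` W) = \<gamma> * (ennreal (r ^ DIM('a)) * scaled_diagonal W r)"
proof -
  interpret palm: prob_space palm
    by (rule prob_space_palm)
  let ?B = "(\<lambda>x. r *\<^sub>R x) ` W"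
  have [measurable]: "?B \<in> sets borel"
    using W r by (rule borel_scaleR_image)
  have "y + r *\<^sub>R u \<in> ?B \<longleftrightarrow> inverse r *\<^sub>R y + u \<in> W" for y u
  proof -
    have "y + r *\<^sub>R u = r *\<^sub>R (inverse r *\<^sub>R y + u)"
      using r by (simp add: scaleR_add_right)
    then show ?thesis
      using r by (auto simp del: scaleR_add_right)
  qed
  then show ?thesis
    unfolding scaled_diagonal_def using r
    by (subst diagonal_palm, measurable, subst nn_integral_lborel_scaleR[OF _ r], measurable)
qed

lemma scaled_diagonal_le:
  assumes W: "W \<in> sets borel" and r: "r > 0"
  shows "scaled_diagonal W r \<le> (\<integral>\<^sup>+\<omega>. emeasure (\<Phi> \<omega>) {0} \<partial>palm) * emeasure lborel W"
proof -
  have "\<gamma> * (ennreal (r ^ DIM('a)) * scaled_diagonal W r)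
      \<le> \<gamma> * (ennreal (r ^ DIM('a)) * ((\<integral>\<^sup>+\<omega>. emeasure (\<Phi> \<omega>) {0} \<partial>palm) * emeasure lborel W))"
    using diagonal_le[OF borel_scaleR_image[OF W r]]
    by (simp add: diagonal_scaleR_image[OF W r] emeasure_lborel_scaleR_image[OF W r] mult_ac)
  then show ?thesis
    using intensity_pos intensity_finite r by (simp add: ennreal_mult_le_mult_iff)
qed

text \<open>Fatou's lemma is used twice, inside for the Palm expectation and outside for the
  integral over u. Points u outside the interior of W are dropped, at no cost in volume by
  convexity.\<close>

lemma le_liminf_scaled_diagonal:
  assumes W[measurable]: "W \<in> sets borel" and c: "convex W" and r: "filterlim r at_top sequentially"
  shows "(\<integral>\<^sup>+\<omega>. emeasure (\<Phi> \<omega>) {0} \<partial>palm) * emeasure lborel W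
    \<le> liminf (\<lambda>n. scaled_diagonal W (r n))"
proof -
  interpret palm: prob_space palm
    by (rule prob_space_palm)
  let ?f = "\<lambda>n u \<omega>. emeasure (\<Phi> \<omega>) {0} * (emeasure (K \<omega> 0) {y. inverse (r n) *\<^sub>R y + u \<in> W})\<^sup>2"
  have lim: "liminf (\<lambda>n. ?f n u \<omega>) = emeasure (\<Phi> \<omega>) {0}"
    if "\<omega> \<in> space M" "u \<in> interior W" for \<omega> u
  proof -
    \<comment> \<open>Local finiteness makes the mass at 0 finite, so multiplication by it is
      continuous on \<open>ennreal\<close>.\<close>
    have "(\<lambda>n. ?f n u \<omega>) \<longlonglongrightarrow> emeasure (\<Phi> \<omega>) {0} * 1\<^sup>2"
      unfolding power2_eq_square
      by (intro ennreal_tendsto_cmult tendsto_mult_ennreal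
          emeasure_kernel_scaled_tendsto_1[OF that(1) W that(2) r])
        (use emeasure_\<Phi>_finite[of \<omega> "{0}"] that in auto)
    then show ?thesis
      by (auto intro!: lim_imp_Liminf)
  qed
  have "(\<integral>\<^sup>+\<omega>. emeasure (\<Phi> \<omega>) {0} \<partial>palm) * emeasure lborel W
      = (\<integral>\<^sup>+u. indicator (interior W) u * (\<integral>\<^sup>+\<omega>. emeasure (\<Phi> \<omega>) {0} \<partial>palm) \<partial>lborel)"
    by (simp add: nn_integral_multc emeasure_lborel_interior_convex[OF W c] mult.commute)
  also have "\<dots> \<le> (\<integral>\<^sup>+u. liminf (\<lambda>n. \<integral>\<^sup>+\<omega>. ?f n u \<omega> \<partial>palm) \<partial>lborel)"
  proof (rule nn_integral_mono)
    fix u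
    have "(\<integral>\<^sup>+\<omega>. emeasure (\<Phi> \<omega>) {0} \<partial>palm) = (\<integral>\<^sup>+\<omega>. liminf (\<lambda>n. ?f n u \<omega>) \<partial>palm)"
      if "u \<in> interior W"
      using that by (intro nn_integral_cong) (simp add: lim)
    moreover have "(\<integral>\<^sup>+\<omega>. liminf (\<lambda>n. ?f n u \<omega>) \<partial>palm) \<le> liminf (\<lambda>n. \<integral>\<^sup>+\<omega>. ?f n u \<omega> \<partial>palm)"
      by (rule nn_integral_liminf) measurable
    ultimately show "indicator (interior W) u * (\<integral>\<^sup>+\<omega>. emeasure (\<Phi> \<omega>) {0} \<partial>palm)
        \<le> liminf (\<lambda>n. \<integral>\<^sup>+\<omega>. ?f n u \<omega> \<partial>palm)"
      by (auto simp: indicator_def)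
  qed
  also have "\<dots> \<le> liminf (\<lambda>n. scaled_diagonal W (r n))"
    unfolding scaled_diagonal_def by (rule nn_integral_liminf) measurable
  finally show ?thesis .
qed

text \<open>Fatou's lemma needs sequences, hence the reduction to arbitrary sequences tending to
  infinity. The liminf bound and the upper bound, valid for every r > 0, enclose the limit.\<close>

lemma scaled_diagonal_tendsto:
  assumes W: "W \<in> sets borel" and c: "convex W"
  shows "(scaled_diagonal W \<longlongrightarrow> (\<integral>\<^sup>+\<omega>. emeasure (\<Phi> \<omega>) {0} \<partial>palm) * emeasure lborel W) at_top"
proof (rule tendsto_at_topI_sequentially)
  fix r :: "nat \<Rightarrow> real" assume r: "filterlim r at_top sequentially"
  show "(\<lambda>n. scaled_diagonal W (r n)) \<longlonglongrightarrow> (\<integral>\<^sup>+\<omega>. emeasure (\<Phi> \<omega>) {0} \<partial>palm) * emeasure lborel W"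
  proof (rule order_tendstoI)
    fix a assume "a < (\<integral>\<^sup>+\<omega>. emeasure (\<Phi> \<omega>) {0} \<partial>palm) * emeasure lborel W"
    then show "\<forall>\<^sub>F n in sequentially. a < scaled_diagonal W (r n)"
      using le_liminf_scaled_diagonal[OF W c r] by (intro less_LiminfD) simp
  next
    fix a assume "(\<integral>\<^sup>+\<omega>. emeasure (\<Phi> \<omega>) {0} \<partial>palm) * emeasure lborel W < a"
    then show "\<forall>\<^sub>F n in sequentially. scaled_diagonal W (r n) < a"
      using filterlim_at_top_dense[THEN iffD1, OF r, rule_format, of 0]
      by (auto elim!: eventually_mono intro: le_less_trans[OF scaled_diagonal_le[OF W]])
  qed
qed

theorem diagonal_asymptotics:
  assumes W: "W \<in> sets borel" and c: "convex W" and b: "bounded W" and i: "interior W \<noteq> {}"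
  shows "((\<lambda>r. enn2real (diagonal ((\<lambda>x. r *\<^sub>R x) ` W)) / measure lborel ((\<lambda>x. r *\<^sub>R x) ` W))
    \<longlongrightarrow> enn2real (\<gamma> * (\<integral>\<^sup>+\<omega>. emeasure (\<Phi> \<omega>) {0} \<partial>palm))) at_top"
proof -
  let ?c = "\<integral>\<^sup>+\<omega>. emeasure (\<Phi> \<omega>) {0} \<partial>palm"
  have fin: "emeasure lborel W < \<infinity>"
    using b by (rule emeasure_bounded_finite)
  \<comment> \<open>A nonempty interior gives positive volume, which is needed for the division
    below.\<close>
  have "0 < emeasure lborel (interior W)"
    using open_not_negligible[OF open_interior i]
    by (auto simp: negligible_iff_null_sets null_sets_completion_iff null_sets_def zero_less_iff_neq_zero)
  then have pos: "0 < measure lborel W"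
    using fin by (simp add: emeasure_lborel_interior_convex[OF W c] measure_def enn2real_positive_iff)
  \<comment> \<open>The limit is finite, so \<open>enn2real\<close> is continuous there.\<close>
  have "((\<lambda>r. enn2real \<gamma> * enn2real (scaled_diagonal W r) / measure lborel W)
      \<longlongrightarrow> enn2real \<gamma> * enn2real (?c * emeasure lborel W) / measure lborel W) at_top"
    using scaled_diagonal_tendsto[OF W c] palm_mass_finite fin pos
    by (intro tendsto_intros tendsto_enn2real)
      (auto simp: ennreal_mult_eq_top_iff ennreal_enn2real_if less_top[symmetric])
  also have "enn2real \<gamma> * enn2real (?c * emeasure lborel W) / measure lborel W = enn2real (\<gamma> * ?c)"
    using pos by (simp add: enn2real_mult measure_def)
  finally show ?thesis
  proof (rule Lim_transform_eventually)
    show "\<forall>\<^sub>F r in at_top. enn2real \<gamma> * enn2real (scaled_diagonal W r) / measure lborel W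
        = enn2real (diagonal ((\<lambda>x. r *\<^sub>R x) ` W)) / measure lborel ((\<lambda>x. r *\<^sub>R x) ` W)"
      using eventually_gt_at_top[of 0]
    proof eventually_elim
      fix r :: real assume r: "0 < r"
      show "enn2real \<gamma> * enn2real (scaled_diagonal W r) / measure lborel W
        = enn2real (diagonal ((\<lambda>x. r *\<^sub>R x) ` W)) / measure lborel ((\<lambda>x. r *\<^sub>R x) ` W)"
        using r pos
        by (simp add: diagonal_scaleR_image[OF W r] measure_def emeasure_lborel_scaleR_image[OF W r] enn2real_mult)
    qed
  qed
qed

end

section \<open>Summation over the atoms\<close>

text \<open>\<open>N\<close> will also be the \<sigma>-field generated by the transport, for which
  \<open>X\<close> and \<open>Y\<close> are not known to be measurable. So the proof may use only
  that \<Phi>(B) is measurable for each fixed B, although the point \<open>Z \<omega>\<close>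
  varies.\<close>

lemma random_measure_point_mass_measurable:
  fixes \<Phi> :: "'w \<Rightarrow> 'a::euclidean_space measure"
  assumes \<Phi>: "random_measure N \<Phi>" and Z[measurable]: "Z \<in> borel_measurable N"
  shows "(\<lambda>\<omega>. emeasure (\<Phi> \<omega>) {Z \<omega>}) \<in> borel_measurable N"
proof -
  have sets: "sets (\<Phi> \<omega>) = sets borel" if "\<omega> \<in> space N" for \<omega>
    using \<Phi> that by (simp add: random_measure_def)
  have [measurable]: "(\<lambda>\<omega>. emeasure (\<Phi> \<omega>) B) \<in> borel_measurable N" if "B \<in> sets borel" for B
    using \<Phi> that by (simp add: random_measure_def)
  have fin: "emeasure (\<Phi> \<omega>) (cball 0 (real R)) < \<infinity>" if "\<omega> \<in> space N" for \<omega> R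
    using \<Phi> that by (simp add: random_measure_def)
  \<comment> \<open>The added 1 keeps the normalising factor nonzero when the ball carries no
    mass.\<close>
  define c where "c R \<omega> = 1 + emeasure (\<Phi> \<omega>) (cball 0 (real R))" for R \<omega>
  have c: "c R \<omega> \<noteq> 0" "c R \<omega> < \<infinity>" if "\<omega> \<in> space N" for R \<omega>
    using fin[OF that, of R] by (auto simp: c_def ennreal_add_eq_top less_top)
  text \<open>The Giry monad only provides measurability of \<open>emeasure (\<mu> \<omega>) (A \<omega>)\<close> for subprobability
    kernels, hence the localisation to balls and the normalisation.\<close>
  define \<mu> where "\<mu> R \<omega> = scale_measure (inverse (c R \<omega>)) (density (\<Phi> \<omega>) (indicator (cball 0 (real R))))"
    for R \<omega>
  have em: "emeasure (\<mu> R \<omega>) B = inverse (c R \<omega>) * emeasure (\<Phi> \<omega>) (cball 0 (real R) \<inter> B)"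
    if "\<omega> \<in> space N" "B \<in> sets borel" for R \<omega> B
  proof -
    have "emeasure (density (\<Phi> \<omega>) (indicator (cball 0 (real R)))) B
        = (\<integral>\<^sup>+x. indicator (cball 0 (real R)) x * indicator B x \<partial>\<Phi> \<omega>)"
      using that sets[OF that(1)]
      by (intro emeasure_density borel_measurable_indicator) simp_all
    also have "\<dots> = (\<integral>\<^sup>+x. indicator (cball 0 (real R) \<inter> B) x \<partial>\<Phi> \<omega>)"
      by (simp add: indicator_inter_arith)
    finally show ?thesis
      using that sets[OF that(1)] by (simp add: \<mu>_def sets.Int)
  qed
  have \<mu>: "\<mu> R \<in> N \<rightarrow>\<^sub>M subprob_algebra borel" for R
  proof (rule measurable_subprob_algebra)
    fix \<omega> assume \<omega>: "\<omega> \<in> space N"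
    have sp: "space (\<mu> R \<omega>) = UNIV"
      using sets_eq_imp_space_eq[OF sets[OF \<omega>]] by (simp add: \<mu>_def space_scale_measure)
    have "emeasure (\<mu> R \<omega>) UNIV = emeasure (\<Phi> \<omega>) (cball 0 (real R)) / c R \<omega>"
      using em[OF \<omega>, of UNIV] by (simp add: divide_ennreal_def mult.commute)
    also have "\<dots> \<le> c R \<omega> / c R \<omega>"
      by (intro divide_right_mono_ennreal) (simp add: c_def)
    also have "\<dots> = 1"
      using c[OF \<omega>] by simp
    finally show "subprob_space (\<mu> R \<omega>)"
      using sp by (intro subprob_spaceI) auto
  next
    fix \<omega> assume \<omega>: "\<omega> \<in> space N"
    show "sets (\<mu> R \<omega>) = sets borel"
      using sets[OF \<omega>] by (simp add: \<mu>_def)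
  next
    fix B :: "'a set" assume [measurable]: "B \<in> sets borel"
    have "(\<lambda>\<omega>. inverse (c R \<omega>) * emeasure (\<Phi> \<omega>) (cball 0 (real R) \<inter> B)) \<in> borel_measurable N"
      unfolding c_def by measurable
    then show "(\<lambda>\<omega>. emeasure (\<mu> R \<omega>) B) \<in> borel_measurable N"
      by (simp add: em cong: measurable_cong)
  qed
  have [measurable]: "(\<lambda>\<omega>. c R \<omega> * emeasure (\<mu> R \<omega>) {Z \<omega>}) \<in> borel_measurable N" for R
  proof -
    have "(SIGMA \<omega>:space N. {Z \<omega>}) = {p \<in> space (N \<Otimes>\<^sub>M borel). snd p = Z (fst p)}"
      by (auto simp: space_pair_measure)
    also have "\<dots> \<in> sets (N \<Otimes>\<^sub>M borel)"
      by measurable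
    finally have [measurable]: "(\<lambda>\<omega>. emeasure (\<mu> R \<omega>) {Z \<omega>}) \<in> borel_measurable N"
      using \<mu> by (rule emeasure_measurable_subprob_algebra2)
    show ?thesis
      unfolding c_def by measurable
  qed
  \<comment> \<open>The radius depends on \<omega> so that the ball contains
    \<open>Z \<omega>\<close>; being integer valued, it leaves only a countable case
    distinction.\<close>
  have "(\<lambda>\<omega>. (\<lambda>R \<omega>. c R \<omega> * emeasure (\<mu> R \<omega>) {Z \<omega>}) (nat \<lceil>norm (Z \<omega>)\<rceil>) \<omega>) \<in> borel_measurable N"
    by (rule measurable_compose_countable) measurable
  moreover have "c R \<omega> * emeasure (\<mu> R \<omega>) {Z \<omega>} = emeasure (\<Phi> \<omega>) {Z \<omega>}"
    if \<omega>: "\<omega> \<in> space N" and "R = nat \<lceil>norm (Z \<omega>)\<rceil>" for R \<omega>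
  proof -
    have "norm (Z \<omega>) \<le> real R"
      unfolding that(2) by linarith
    then have "cball 0 (real R) \<inter> {Z \<omega>} = {Z \<omega>}"
      by auto
    then show ?thesis
      using ennreal_divide_self[of "c R \<omega>"] c[OF \<omega>, of R]
      by (simp add: em[OF \<omega>] mult.assoc[symmetric] divide_ennreal_def)
  qed
  ultimately show ?thesis
    by (simp cong: measurable_cong)
qed

text \<open>\<open>real_cond_exp\<close> is the difference of the conditional expectations of the
  positive and negative parts. For 0 \<le> g \<le> 1 the second vanishes and the first is at most 1
  almost surely, so it agrees with \<open>nn_cond_exp\<close>. The weight \<open>f\<close> may then
  be non-integrable or infinite.\<close>

lemma (in sigma_finite_subalgebra) nn_integral_mult_real_cond_exp:
  assumes f[measurable]: "f \<in> borel_measurable F" and g[measurable]: "g \<in> borel_measurable M"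
    and nonneg: "\<And>x. 0 \<le> g x" and bound: "\<And>x. x \<in> space M \<Longrightarrow> g x \<le> 1"
  shows "(\<integral>\<^sup>+x. f x * ennreal (real_cond_exp M F g x) \<partial>M) = (\<integral>\<^sup>+x. f x * ennreal (g x) \<partial>M)"
proof -
  have "AE x in M. (1::ennreal) = nn_cond_exp M F (\<lambda>_. 1) x"
    by (rule nn_cond_exp_F_meas) simp
  moreover have "AE x in M. nn_cond_exp M F (\<lambda>x. ennreal (g x)) x \<le> nn_cond_exp M F (\<lambda>_. 1) x"
    by (rule nn_cond_exp_mono) (use bound in auto)
  moreover have "AE x in M. (0::ennreal) = nn_cond_exp M F (\<lambda>_. 0) x"
    by (rule nn_cond_exp_F_meas) simp
  ultimately have "AE x in M. ennreal (real_cond_exp M F g x) = nn_cond_exp M F (\<lambda>x. ennreal (g x)) x"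
  proof eventually_elim
    case (elim x)
    have "(\<lambda>x. ennreal (- g x)) = (\<lambda>_. 0)"
      using nonneg by (auto simp: ennreal_neg)
    moreover have "nn_cond_exp M F (\<lambda>x. ennreal (g x)) x < top"
      using elim by (metis ennreal_one_less_top le_less_trans)
    ultimately show ?case
      using elim(3) by (simp add: real_cond_exp_def)
  qed
  then have "(\<integral>\<^sup>+x. f x * ennreal (real_cond_exp M F g x) \<partial>M)
      = (\<integral>\<^sup>+x. f x * nn_cond_exp M F (\<lambda>x. ennreal (g x)) x \<partial>M)"
    by (intro nn_integral_cong_AE) auto
  then show ?thesis
    by (simp add: nn_cond_exp_intg)
qed

text \<open>The terms may be infinite, so nothing is subtracted: each row is written as its
  off-diagonal terms plus a series supported at n = m.\<close>

lemma suminf_square_ennreal: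
  fixes c :: "nat \<Rightarrow> ennreal"
  shows "(\<Sum>n. c n)\<^sup>2 = (\<Sum>m. \<Sum>n. if m = n then 0 else c m * c n) + (\<Sum>n. (c n)\<^sup>2)"
proof -
  have split: "(\<Sum>n. c m * c n) = (\<Sum>n. if m = n then 0 else c m * c n) + (c m)\<^sup>2" for m
  proof -
    have "(\<Sum>n. c m * c n) = (\<Sum>n. (if m = n then 0 else c m * c n) + (if n = m then (c m)\<^sup>2 else 0))"
      by (rule suminf_cong) (simp add: power2_eq_square)
    also have "\<dots> = (\<Sum>n. if m = n then 0 else c m * c n) + (\<Sum>n. if n = m then (c m)\<^sup>2 else 0)"
      by (rule suminf_add[symmetric]) auto
    also have "(\<Sum>n. if n = m then (c m)\<^sup>2 else 0) = (c m)\<^sup>2"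
      by (subst suminf_finite[of "{m}"]) auto
    finally show ?thesis .
  qed
  have "(\<Sum>n. c n)\<^sup>2 = (\<Sum>m. \<Sum>n. c m * c n)"
    by (simp add: power2_eq_square)
  also have "\<dots> = (\<Sum>m. (\<Sum>n. if m = n then 0 else c m * c n) + (c m)\<^sup>2)"
    unfolding split ..
  also have "\<dots> = (\<Sum>m. \<Sum>n. if m = n then 0 else c m * c n) + (\<Sum>n. (c n)\<^sup>2)"
    by (rule suminf_add[symmetric]) auto
  finally show ?thesis .
qed

context stationary_point_masses
begin

text \<open>The enumeration \<open>Z\<close> of the atoms may contain repetitions and points without mass; the
  weights count every atom at its first occurrence only.\<close>

definition first_mass :: "(nat \<Rightarrow> 'w \<Rightarrow> 'a) \<Rightarrow> nat \<Rightarrow> 'w \<Rightarrow> ennreal" where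
  "first_mass Z n \<omega> = (if \<exists>k<n. Z k \<omega> = Z n \<omega> then 0 else emeasure (\<Phi> \<omega>) {Z n \<omega>})"

text \<open>A general \<open>N\<close> is allowed because the weights must be measurable both for
  \<open>M\<close> and for the \<sigma>-field of the transport.\<close>

lemma first_mass_measurable:
  assumes \<Phi>: "random_measure N \<Phi>" and Z[measurable]: "\<And>n. Z n \<in> borel_measurable N"
  shows "first_mass Z n \<in> borel_measurable N"
proof -
  note [measurable] = random_measure_point_mass_measurable[OF \<Phi> Z]
  have "(\<lambda>\<omega>. if \<exists>k\<in>{..<n}. Z k \<omega> = Z n \<omega> then 0 else emeasure (\<Phi> \<omega>) {Z n \<omega>}) \<in> borel_measurable N"
    by measurable
  then show ?thesis
    unfolding first_mass_def[abs_def] by (simp add: Bex_def)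
qed

text \<open>Two nonzero weights put \<omega> into the event on which the conditional hypothesis
  speaks: if the points coincided, the later index would have weight 0.\<close>

lemma first_mass_pos:
  assumes "first_mass Z m \<omega> \<noteq> 0" "first_mass Z n \<omega> \<noteq> 0" "m \<noteq> n"
  shows "Z m \<omega> \<in> atoms (\<Phi> \<omega>)" "Z n \<omega> \<in> atoms (\<Phi> \<omega>)" "Z m \<omega> \<noteq> Z n \<omega>"
proof -
  show "Z m \<omega> \<in> atoms (\<Phi> \<omega>)" "Z n \<omega> \<in> atoms (\<Phi> \<omega>)"
    using assms by (auto simp: first_mass_def atoms_def zero_less_iff_neq_zero split: if_splits)
  show "Z m \<omega> \<noteq> Z n \<omega>"
    using assms by (cases m n rule: linorder_cases) (auto simp: first_mass_def split: if_splits)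
qed

text \<open>The sets \<open>D n\<close> below are disjoint and cover the range of \<open>Z\<close>.
  There is no mass outside this range, since a point \<open>X n\<close> with \<open>Y n\<close> > 0
  is an atom and hence enumerated.\<close>

lemma nn_integral_\<Phi>_atoms:
  assumes \<omega>: "\<omega> \<in> space M" and Z: "atoms (\<Phi> \<omega>) \<subseteq> range (\<lambda>n. Z n \<omega>)"
    and f: "f \<in> borel_measurable borel"
  shows "(\<integral>\<^sup>+x. f x \<partial>\<Phi> \<omega>) = (\<Sum>n. first_mass Z n \<omega> * f (Z n \<omega>))"
proof -
  let ?S = "range (\<lambda>n. Z n \<omega>)"
  define D where "D n = (if \<exists>k<n. Z k \<omega> = Z n \<omega> then {} else {Z n \<omega>})" for n
  have D: "D n \<in> sets borel" for n
    by (simp add: D_def)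
  have S: "?S \<in> sets borel"
    by (rule sets.countable) auto
  have vanish: "ennreal (Y n \<omega>) * indicator (- ?S) (X n \<omega>) = 0" for n
  proof (cases "X n \<omega> \<in> ?S")
    case False
    then have "emeasure (\<Phi> \<omega>) {X n \<omega>} = 0"
      using Z by (auto simp: atoms_def zero_less_iff_neq_zero)
    moreover have "ennreal (Y n \<omega>) * indicator {X n \<omega>} (X n \<omega>) \<le> emeasure (\<Phi> \<omega>) {X n \<omega>}"
      using sum_le_suminf[of "\<lambda>k. ennreal (Y k \<omega>) * indicator {X n \<omega>} (X k \<omega>)" "{n}"] \<omega>
      by (simp add: emeasure_\<Phi>)
    ultimately show ?thesis by simp
  qed simp
  have "emeasure (\<Phi> \<omega>) (- ?S) = (\<Sum>n. ennreal (Y n \<omega>) * indicator (- ?S) (X n \<omega>))"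
    by (rule emeasure_\<Phi>[OF \<omega>]) (use S in auto)
  also have "\<dots> = 0"
    unfolding vanish by simp
  finally have "AE x in \<Phi> \<omega>. x \<in> ?S"
    using S \<omega> by (intro AE_I[of _ _ "- ?S"]) (auto simp: sets_\<Phi> space_\<Phi>)
  then have "(\<integral>\<^sup>+x. f x \<partial>\<Phi> \<omega>) = (\<integral>\<^sup>+x. (\<Sum>n. f (Z n \<omega>) * indicator (D n) x) \<partial>\<Phi> \<omega>)"
  proof (intro nn_integral_cong_AE, eventually_elim)
    case (elim x)
    define m where "m = (LEAST n. Z n \<omega> = x)"
    have m: "Z m \<omega> = x"
      using elim unfolding m_def by (auto intro: LeastI)
    have mem: "x \<in> D n \<longleftrightarrow> n = m" for n
    proof
      assume "x \<in> D n"
      then have "Z n \<omega> = x" "\<forall>k<n. Z k \<omega> \<noteq> x"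
        by (auto simp: D_def split: if_splits)
      then have "m = n"
        unfolding m_def by (intro Least_equality) (auto simp: linorder_not_less[symmetric])
      then show "n = m" ..
    next
      have "Z k \<omega> \<noteq> x" if "k < m" for k
        using that unfolding m_def by (rule not_less_Least)
      moreover assume "n = m"
      ultimately show "x \<in> D n"
        using m by (auto simp: D_def)
    qed
    show ?case
      by (subst suminf_finite[of "{m}"]) (auto simp: mem m indicator_def)
  qed
  also have "\<dots> = (\<Sum>n. f (Z n \<omega>) * emeasure (\<Phi> \<omega>) (D n))"
    using D by (subst nn_integral_suminf)
      (auto simp: sets_\<Phi>[OF \<omega>] nn_integral_cmult_indicator measurable_cong_sets[OF sets_\<Phi>[OF \<omega>] refl])
  also have "\<dots> = (\<Sum>n. first_mass Z n \<omega> * f (Z n \<omega>))"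
    by (intro suminf_cong) (auto simp: D_def first_mass_def mult.commute)
  finally show ?thesis .
qed

end

context stationary_transport
begin

text \<open>The enumeration is an argument, so that the moments for \<open>K\<close> and
  \<open>L\<close> can be compared along the same points.\<close>

definition pair_moment :: "(nat \<Rightarrow> 'w \<Rightarrow> 'a) \<Rightarrow> 'a set \<Rightarrow> nat \<Rightarrow> nat \<Rightarrow> ennreal" where
  "pair_moment Z B m n = (\<integral>\<^sup>+\<omega>. first_mass Z m \<omega> * first_mass Z n \<omega>
     * (emeasure (K \<omega> (Z m \<omega>)) B * emeasure (K \<omega> (Z n \<omega>)) B) \<partial>M)"

lemma second_moment_kernel_image:
  assumes Z[measurable]: "\<And>n. Z n \<in> borel_measurable M"
    and atoms: "\<And>\<omega>. \<omega> \<in> space M \<Longrightarrow> atoms (\<Phi> \<omega>) \<subseteq> range (\<lambda>n. Z n \<omega>)"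
    and B[measurable]: "B \<in> sets borel"
  shows "(\<integral>\<^sup>+\<omega>. (emeasure (kernel_image K \<Phi> \<omega>) B)\<^sup>2 \<partial>M)
    = (\<Sum>m. \<Sum>n. if m = n then 0 else pair_moment Z B m n) + diagonal B"
proof -
  note [measurable] = first_mass_measurable[OF random Z]
  let ?c = "\<lambda>n \<omega>. first_mass Z n \<omega> * emeasure (K \<omega> (Z n \<omega>)) B"
  have "(\<integral>\<^sup>+\<omega>. (emeasure (kernel_image K \<Phi> \<omega>) B)\<^sup>2 \<partial>M)
      = (\<integral>\<^sup>+\<omega>. (\<Sum>m. \<Sum>n. if m = n then 0 else ?c m \<omega> * ?c n \<omega>) + (\<Sum>n. (?c n \<omega>)\<^sup>2) \<partial>M)"
  proof (rule nn_integral_cong)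
    fix \<omega> assume \<omega>[measurable]: "\<omega> \<in> space M"
    have "emeasure (kernel_image K \<Phi> \<omega>) B = (\<Sum>n. ?c n \<omega>)"
      unfolding emeasure_kernel_image[OF random kernel \<omega> B]
      by (rule nn_integral_\<Phi>_atoms[of \<omega> Z, OF \<omega> atoms[OF \<omega>]]) measurable
    then show "(emeasure (kernel_image K \<Phi> \<omega>) B)\<^sup>2
        = (\<Sum>m. \<Sum>n. if m = n then 0 else ?c m \<omega> * ?c n \<omega>) + (\<Sum>n. (?c n \<omega>)\<^sup>2)"
      by (simp add: suminf_square_ennreal)
  qed
  also have "\<dots> = (\<integral>\<^sup>+\<omega>. (\<Sum>m. \<Sum>n. if m = n then 0 else ?c m \<omega> * ?c n \<omega>) \<partial>M)
      + (\<integral>\<^sup>+\<omega>. (\<Sum>n. (?c n \<omega>)\<^sup>2) \<partial>M)"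
    by (rule nn_integral_add) measurable
  also have "(\<integral>\<^sup>+\<omega>. (\<Sum>m. \<Sum>n. if m = n then 0 else ?c m \<omega> * ?c n \<omega>) \<partial>M)
      = (\<Sum>m. \<Sum>n. \<integral>\<^sup>+\<omega>. (if m = n then 0 else ?c m \<omega> * ?c n \<omega>) \<partial>M)"
    by (simp add: nn_integral_suminf)
  also have "\<dots> = (\<Sum>m. \<Sum>n. if m = n then 0 else pair_moment Z B m n)"
    by (intro suminf_cong) (auto simp: pair_moment_def mult_ac intro!: nn_integral_cong)
  \<comment> \<open>\<open>first_mass\<close> is either 0 or the mass of the point, so its square is
    itself times this mass. One factor becomes integration against \<Phi>, and the diagonal no
    longer depends on \<open>Z\<close>.\<close>
  also have "(\<integral>\<^sup>+\<omega>. (\<Sum>n. (?c n \<omega>)\<^sup>2) \<partial>M) = diagonal B"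
    unfolding diagonal_def
  proof (rule nn_integral_cong)
    fix \<omega> assume \<omega>[measurable]: "\<omega> \<in> space M"
    have "(\<integral>\<^sup>+x. emeasure (\<Phi> \<omega>) {x} * (emeasure (K \<omega> x) B)\<^sup>2 \<partial>\<Phi> \<omega>)
        = (\<Sum>n. first_mass Z n \<omega> * (emeasure (\<Phi> \<omega>) {Z n \<omega>} * (emeasure (K \<omega> (Z n \<omega>)) B)\<^sup>2))"
      by (rule nn_integral_\<Phi>_atoms[of \<omega> Z, OF \<omega> atoms[OF \<omega>]]) measurable
    then show "(\<Sum>n. (?c n \<omega>)\<^sup>2) = (\<integral>\<^sup>+x. emeasure (\<Phi> \<omega>) {x} * (emeasure (K \<omega> x) B)\<^sup>2 \<partial>\<Phi> \<omega>)"
      by (auto simp: first_mass_def power2_eq_square mult_ac intro!: suminf_cong)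
  qed
  finally show ?thesis .
qed

end

section \<open>Conditioning on the transport\<close>

lemma space_sigma_of: "space (sigma_of N S) = space N"
  by (simp add: sigma_of_def space_measure_of_conv)

lemma sigma_of_sets_Pow:
  "{(\<lambda>\<omega>. emeasure (S \<omega>) C) -` U \<inter> space N | C U. C \<in> sets borel \<and> U \<in> sets borel} \<subseteq> Pow (space N)"
  by auto

lemma emeasure_measurable_sigma_of:
  assumes "C \<in> sets borel"
  shows "(\<lambda>\<omega>. emeasure (S \<omega>) C) \<in> borel_measurable (sigma_of N S)"
proof (rule measurableI)
  fix U :: "ennreal set" assume "U \<in> sets borel"
  then show "(\<lambda>\<omega>. emeasure (S \<omega>) C) -` U \<inter> space (sigma_of N S) \<in> sets (sigma_of N S)"
    using assms unfolding space_sigma_of unfolding sigma_of_def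
    by (subst sets_measure_of[OF sigma_of_sets_Pow]) (auto intro!: sigma_sets.Basic)
qed simp

context stationary_transport
begin

lemma measurable_transport:
  assumes [measurable]: "C \<in> sets borel"
  shows "(\<lambda>\<omega>. emeasure (transport K \<Phi> \<omega>) C) \<in> borel_measurable M"
proof -
  have [measurable]: "C \<in> sets (borel \<Otimes>\<^sub>M borel)"
    unfolding borel_prod by (rule assms)
  have "(\<lambda>\<omega>. \<integral>\<^sup>+x. emeasure (K \<omega> x) {y. (x, y) \<in> C} \<partial>\<Phi> \<omega>) \<in> borel_measurable M"
    by (rule measurable_nn_integral_\<Phi>) measurable
  then show ?thesis
    by (simp add: emeasure_transport[OF random kernel] cong: measurable_cong)
qed

lemma subalgebra_sigma_of_transport: "subalgebra M (sigma_of M (transport K \<Phi>))"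
proof -
  have "sets (sigma_of M (transport K \<Phi>)) \<subseteq> sets M"
    unfolding sigma_of_def sets_measure_of[OF sigma_of_sets_Pow]
    by (rule sets.sigma_sets_subset) (auto intro: measurable_sets measurable_transport)
  then show ?thesis
    by (simp add: subalgebra_def space_sigma_of)
qed

text \<open>The kernel has total mass 1, so the first marginal of the transport is \<Phi>, and
  \<Phi>(B) is the mass of B \<times> UNIV.\<close>

lemma random_measure_sigma_of_transport: "random_measure (sigma_of M (transport K \<Phi>)) \<Phi>"
proof -
  have "(\<lambda>\<omega>. emeasure (\<Phi> \<omega>) B) \<in> borel_measurable (sigma_of M (transport K \<Phi>))"
    if B: "B \<in> sets borel" for B
  proof -
    have C: "B \<times> UNIV \<in> sets (borel :: ('a \<times> 'a) measure)"
      using B by (simp add: borel_prod[symmetric])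
    have "emeasure (transport K \<Phi> \<omega>) (B \<times> UNIV) = emeasure (\<Phi> \<omega>) B" if \<omega>: "\<omega> \<in> space M" for \<omega>
    proof -
      have "emeasure (transport K \<Phi> \<omega>) (B \<times> UNIV) = (\<integral>\<^sup>+x. indicator B x \<partial>\<Phi> \<omega>)"
        unfolding emeasure_transport[OF random kernel \<omega> C]
      proof (rule nn_integral_cong)
        fix x
        show "emeasure (K \<omega> x) {y. (x, y) \<in> B \<times> UNIV} = indicator B x"
          using prob_space.emeasure_space_1[OF prob_space_kernel[OF \<omega>, of x]]
          by (cases "x \<in> B") (simp_all add: space_kernel[OF \<omega>])
      qed
      then show ?thesis
        using B by (simp add: sets_\<Phi>[OF \<omega>])
    qed
    then show ?thesis
      using emeasure_measurable_sigma_of[OF C, of "transport K \<Phi>" M]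
      by (subst measurable_cong[where g="\<lambda>\<omega>. emeasure (transport K \<Phi> \<omega>) (B \<times> UNIV)"])
        (simp_all add: space_sigma_of)
  qed
  then show ?thesis
    using random by (simp add: random_measure_def space_sigma_of)
qed

text \<open>\<open>\<Phi> {Z m} \<Phi> {Z n}\<close> is a function of the transport, so it can be pulled out of the
  conditional expectation.\<close>

lemma pair_moment_conditional:
  assumes L: "stationary_transport M \<theta> \<Phi> Y X L"
    and Z: "\<And>n. Z n \<in> borel_measurable (sigma_of M (transport L \<Phi>))"
    and B: "B \<in> sets borel" and mn: "m \<noteq> n"
    and cond: "AE \<omega> in M. Z m \<omega> \<in> atoms (\<Phi> \<omega>) \<and> Z n \<omega> \<in> atoms (\<Phi> \<omega>) \<and> Z m \<omega> \<noteq> Z n \<omega> \<longrightarrow>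
      real_cond_exp M (sigma_of M (transport L \<Phi>))
        (\<lambda>\<omega>. measure (K \<omega> (Z m \<omega>) \<Otimes>\<^sub>M K \<omega> (Z n \<omega>)) (B \<times> B)) \<omega> =
      measure (L \<omega> (Z m \<omega>) \<Otimes>\<^sub>M L \<omega> (Z n \<omega>)) (B \<times> B)"
  shows "pair_moment Z B m n = stationary_transport.pair_moment M \<Phi> L Z B m n"
proof -
  interpret L: stationary_transport M \<theta> \<Phi> Y X L
    by fact
  let ?F = "sigma_of M (transport L \<Phi>)"
  interpret F: finite_measure_subalgebra M ?F
    using L.subalgebra_sigma_of_transport by unfold_locales
  \<comment> \<open>The hypothesis speaks of real-valued product measures; for probability kernels
    these factorise in \<open>ennreal\<close>. \<open>H\<close> stands for \<open>K\<close> and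
    \<open>L\<close> in turn.\<close>
  have product: "ennreal (measure (H \<omega> x \<Otimes>\<^sub>M H \<omega> y) (B \<times> B)) = emeasure (H \<omega> x) B * emeasure (H \<omega> y) B"
    and product_le: "measure (H \<omega> x \<Otimes>\<^sub>M H \<omega> y) (B \<times> B) \<le> 1"
    if H: "prob_kernel M H" and \<omega>: "\<omega> \<in> space M" for H :: "'w \<Rightarrow> 'a \<Rightarrow> 'a measure" and \<omega> x y
  proof -
    interpret H: prob_kernel M H
      by fact
    interpret x: prob_space "H \<omega> x"
      using \<omega> by (rule H.prob_space_kernel)
    interpret y: prob_space "H \<omega> y"
      using \<omega> by (rule H.prob_space_kernel)
    interpret P: pair_prob_space "H \<omega> x" "H \<omega> y" ..
    show "ennreal (measure (H \<omega> x \<Otimes>\<^sub>M H \<omega> y) (B \<times> B)) = emeasure (H \<omega> x) B * emeasure (H \<omega> y) B"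
      using B by (simp add: P.P.emeasure_eq_measure[symmetric] y.emeasure_pair_measure_Times H.sets_kernel[OF \<omega>])
    show "measure (H \<omega> x \<Otimes>\<^sub>M H \<omega> y) (B \<times> B) \<le> 1"
      by simp
  qed
  let ?f = "\<lambda>\<omega>. first_mass Z m \<omega> * first_mass Z n \<omega>"
  let ?g = "\<lambda>\<omega>. measure (K \<omega> (Z m \<omega>) \<Otimes>\<^sub>M K \<omega> (Z n \<omega>)) (B \<times> B)"
  have Zm[measurable]: "Z k \<in> borel_measurable M" for k
    by (rule measurable_from_subalg[OF L.subalgebra_sigma_of_transport Z])
  have f: "?f \<in> borel_measurable ?F"
    by (intro borel_measurable_times_ennreal first_mass_measurable L.random_measure_sigma_of_transport Z)
  \<comment> \<open>Measurability of \<open>?g\<close> is read off from its factorised form.\<close>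
  have "(\<lambda>\<omega>. enn2real (emeasure (K \<omega> (Z m \<omega>)) B * emeasure (K \<omega> (Z n \<omega>)) B)) \<in> borel_measurable M"
    using B by measurable
  moreover have "?g \<omega> = enn2real (emeasure (K \<omega> (Z m \<omega>)) B * emeasure (K \<omega> (Z n \<omega>)) B)"
    if "\<omega> \<in> space M" for \<omega>
    using product[OF prob_kernel_axioms that, of "Z m \<omega>" "Z n \<omega>", symmetric] by simp
  ultimately have g: "?g \<in> borel_measurable M"
    by (simp cong: measurable_cong)
  have "pair_moment Z B m n = (\<integral>\<^sup>+\<omega>. ?f \<omega> * ennreal (?g \<omega>) \<partial>M)"
    unfolding pair_moment_def by (intro nn_integral_cong) (simp add: product[OF prob_kernel_axioms])
  also have "\<dots> = (\<integral>\<^sup>+\<omega>. ?f \<omega> * ennreal (real_cond_exp M ?F ?g \<omega>) \<partial>M)"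
    by (rule F.nn_integral_mult_real_cond_exp[OF f g, symmetric])
      (auto intro: product_le[OF prob_kernel_axioms])
  also have "\<dots> = (\<integral>\<^sup>+\<omega>. ?f \<omega> * (emeasure (L \<omega> (Z m \<omega>)) B * emeasure (L \<omega> (Z n \<omega>)) B) \<partial>M)"
  proof (rule nn_integral_cong_AE)
    show "AE \<omega> in M. ?f \<omega> * ennreal (real_cond_exp M ?F ?g \<omega>)
        = ?f \<omega> * (emeasure (L \<omega> (Z m \<omega>)) B * emeasure (L \<omega> (Z n \<omega>)) B)"
      using cond AE_space
    proof eventually_elim
      case (elim \<omega>)
      show ?case
      \<comment> \<open>If a weight vanishes, both sides are 0; otherwise the points are distinct
        atoms and \<open>cond\<close> applies.\<close>
      proof (cases "first_mass Z m \<omega> = 0 \<or> first_mass Z n \<omega> = 0")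
        case False
        then show ?thesis
          using elim first_mass_pos[OF _ _ mn, of Z \<omega>] product[OF L.prob_kernel_axioms elim(2)] by simp
      qed auto
    qed
  qed
  also have "\<dots> = L.pair_moment Z B m n"
    unfolding L.pair_moment_def ..
  finally show ?thesis .
qed

end

section \<open>Variance asymptotics\<close>

text \<open>The limit may be infinite: addition in \<open>ereal\<close> is still continuous when one
  summand has a finite limit.\<close>

lemma tendsto_ereal_add_null:
  fixes f g :: "'b \<Rightarrow> real"
  assumes f: "((\<lambda>x. ereal (f x)) \<longlongrightarrow> l) F" and fg: "((\<lambda>x. f x - g x) \<longlongrightarrow> 0) F"
  shows "((\<lambda>x. ereal (g x)) \<longlongrightarrow> l) F"
proof -
  have "((\<lambda>x. ereal (f x) + ereal (- (f x - g x))) \<longlongrightarrow> l + ereal (- 0)) F"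
    by (intro tendsto_add_ereal_general1 f tendsto_ereal tendsto_minus fg) simp
  then show ?thesis
    by simp
qed

context stationary_transport
begin

lemma measurable_kernel_image[measurable]:
  assumes [measurable]: "B \<in> sets borel"
  shows "(\<lambda>\<omega>. emeasure (kernel_image K \<Phi> \<omega>) B) \<in> borel_measurable M"
proof -
  have "(\<lambda>\<omega>. \<integral>\<^sup>+x. emeasure (K \<omega> x) B \<partial>\<Phi> \<omega>) \<in> borel_measurable M"
    by (rule measurable_nn_integral_\<Phi>) measurable
  then show ?thesis
    using assms by (simp add: emeasure_kernel_image[OF random kernel] cong: measurable_cong)
qed

lemma sets_kernel_image:
  assumes \<omega>: "\<omega> \<in> space M"
  shows "sets (kernel_image K \<Phi> \<omega>) = sets borel"
  unfolding kernel_image_def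
  by (rule sets_bind) (simp_all add: sets_kernel[OF \<omega>] space_\<Phi>[OF \<omega>])

text \<open>This is \<open>transported_mass\<close> with g = 1. The value does not involve the
  kernel, so the squared means cancel when \<open>K\<close> and \<open>L\<close> are
  compared.\<close>

lemma nn_integral_kernel_image:
  assumes B: "B \<in> sets borel"
  shows "(\<integral>\<^sup>+\<omega>. emeasure (kernel_image K \<Phi> \<omega>) B \<partial>M) = \<gamma> * emeasure lborel B"
proof -
  interpret palm: prob_space palm
    by (rule prob_space_palm)
  have "(\<integral>\<^sup>+\<omega>. emeasure (kernel_image K \<Phi> \<omega>) B \<partial>M)
      = (\<integral>\<^sup>+\<omega>. \<integral>\<^sup>+x. 1 * emeasure (K \<omega> x) B \<partial>\<Phi> \<omega> \<partial>M)"
    using B by (intro nn_integral_cong) (simp add: emeasure_kernel_image[OF random kernel])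
  also have "\<dots> = \<gamma> * ((\<integral>\<^sup>+\<omega>. 1 \<partial>palm) * emeasure lborel B)"
    by (rule transported_mass) (use B in simp_all)
  finally show ?thesis
    using palm.emeasure_space_1 by simp
qed

lemma variance_kernel_image:
  assumes B[measurable]: "B \<in> sets borel"
    and bounded: "bounded B"
    and fin: "(\<integral>\<^sup>+\<omega>. (emeasure (kernel_image K \<Phi> \<omega>) B)\<^sup>2 \<partial>M) < \<infinity>"
  shows "variance (\<lambda>\<omega>. measure (kernel_image K \<Phi> \<omega>) B)
    = enn2real (\<integral>\<^sup>+\<omega>. (emeasure (kernel_image K \<Phi> \<omega>) B)\<^sup>2 \<partial>M) - (enn2real (\<gamma> * emeasure lborel B))\<^sup>2"
proof -
  let ?e = "\<lambda>\<omega>. emeasure (kernel_image K \<Phi> \<omega>) B"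
  let ?m = "\<lambda>\<omega>. measure (kernel_image K \<Phi> \<omega>) B"
  have mean: "(\<integral>\<^sup>+\<omega>. ?e \<omega> \<partial>M) < \<infinity>"
    using intensity_finite emeasure_bounded_finite[OF bounded]
    by (simp add: nn_integral_kernel_image ennreal_mult_less_top)
  have m[measurable]: "?m \<in> borel_measurable M"
    unfolding measure_def by measurable
  \<comment> \<open>K\<Phi>(B) may be infinite for some \<omega>, where \<open>measure\<close> takes
    the default value 0. The finite mean confines this to a null set.\<close>
  have "AE \<omega> in M. ?e \<omega> \<noteq> \<infinity>"
    using mean by (intro nn_integral_noteq_infinite) auto
  then have e: "AE \<omega> in M. ennreal (?m \<omega>) = ?e \<omega>"
    by eventually_elim (simp add: emeasure_eq_ennreal_measure)
  have int1: "(\<integral>\<^sup>+\<omega>. ennreal (?m \<omega>) \<partial>M) = (\<integral>\<^sup>+\<omega>. ?e \<omega> \<partial>M)"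
    using e by (rule nn_integral_cong_AE)
  have int2: "(\<integral>\<^sup>+\<omega>. ennreal ((?m \<omega>)\<^sup>2) \<partial>M) = (\<integral>\<^sup>+\<omega>. (?e \<omega>)\<^sup>2 \<partial>M)"
    by (rule nn_integral_cong_AE) (use e in \<open>auto simp: ennreal_power[symmetric]\<close>)
  have second: "expectation (\<lambda>\<omega>. (?m \<omega>)\<^sup>2) = enn2real (\<integral>\<^sup>+\<omega>. (?e \<omega>)\<^sup>2 \<partial>M)"
    by (subst integral_eq_nn_integral) (auto simp: int2)
  have first: "expectation ?m = enn2real (\<gamma> * emeasure lborel B)"
    by (subst integral_eq_nn_integral) (auto simp: int1 nn_integral_kernel_image)
  have "variance ?m = expectation (\<lambda>\<omega>. (?m \<omega>)\<^sup>2) - (expectation ?m)\<^sup>2"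
    using mean fin by (intro variance_eq integrableI_nonneg) (simp_all add: int1 int2)
  then show ?thesis
    unfolding first second .
qed

text \<open>Scaling by r > 0 preserves and reflects Borel sets, so rW is not Borel either and
  \<open>measure\<close> takes its default value 0 there.\<close>

lemma normalized_variance_not_borel:
  assumes W: "W \<notin> sets borel" and r: "r > 0"
  shows "normalized_variance M (kernel_image K \<Phi>) W r = 0"
proof -
  have "(\<lambda>x. r *\<^sub>R x) ` W \<notin> sets borel"
    using W borel_scaleR_image_iff[OF r, of W] by simp
  then have z: "measure (kernel_image K \<Phi> \<omega>) ((\<lambda>x. r *\<^sub>R x) ` W) = 0" if "\<omega> \<in> space M" for \<omega>
    using that by (simp add: measure_notin_sets sets_kernel_image)
  have "expectation (\<lambda>\<omega>. measure (kernel_image K \<Phi> \<omega>) ((\<lambda>x. r *\<^sub>R x) ` W)) = expectation (\<lambda>\<omega>. 0)"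
    by (rule Bochner_Integration.integral_cong[OF refl z])
  then have "variance (\<lambda>\<omega>. measure (kernel_image K \<Phi> \<omega>) ((\<lambda>x. r *\<^sub>R x) ` W)) = expectation (\<lambda>\<omega>. 0)"
    by (intro Bochner_Integration.integral_cong) (simp_all add: z)
  then show ?thesis
    by (simp add: normalized_variance_def)
qed

text \<open>The existential quantifier hides the enumeration \<open>Z\<close>. \<open>P B\<close> is
  the off-diagonal part, the same for both kernels term by term by
  \<open>pair_moment_conditional\<close>, and possibly infinite.\<close>

lemma second_moments_conditional:
  assumes L: "stationary_transport M \<theta> \<Phi> Y X L"
    and cond: "cond_product_kernel M \<Phi> (transport L \<Phi>) K L"
  shows "\<exists>P. \<forall>B\<in>sets borel.
    (\<integral>\<^sup>+\<omega>. (emeasure (kernel_image K \<Phi> \<omega>) B)\<^sup>2 \<partial>M) = P B + diagonal B \<and>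
    (\<integral>\<^sup>+\<omega>. (emeasure (kernel_image L \<Phi> \<omega>) B)\<^sup>2 \<partial>M) = P B + stationary_transport.diagonal M \<Phi> L B"
proof -
  interpret L: stationary_transport M \<theta> \<Phi> Y X L
    by fact
  obtain Z :: "nat \<Rightarrow> 'w \<Rightarrow> 'a"
    where Z: "\<forall>n. Z n \<in> borel_measurable (sigma_of M (transport L \<Phi>))"
    and atoms: "\<forall>\<omega>\<in>space M. atoms (\<Phi> \<omega>) \<subseteq> range (\<lambda>n. Z n \<omega>)"
    and ce: "\<forall>m n. \<forall>C\<in>sets (borel \<Otimes>\<^sub>M borel). AE \<omega> in M.
           Z m \<omega> \<in> atoms (\<Phi> \<omega>) \<and> Z n \<omega> \<in> atoms (\<Phi> \<omega>) \<and> Z m \<omega> \<noteq> Z n \<omega> \<longrightarrow>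
           real_cond_exp M (sigma_of M (transport L \<Phi>))
             (\<lambda>\<omega>. measure (K \<omega> (Z m \<omega>) \<Otimes>\<^sub>M K \<omega> (Z n \<omega>)) C) \<omega> =
           measure (L \<omega> (Z m \<omega>) \<Otimes>\<^sub>M L \<omega> (Z n \<omega>)) C"
    using cond unfolding cond_product_kernel_def by blast
  note Z = Z[rule_format] and atoms = atoms[rule_format] and ce = ce[rule_format]
  have ZM: "Z n \<in> borel_measurable M" for n
    by (rule measurable_from_subalg[OF L.subalgebra_sigma_of_transport Z])
  let ?P = "\<lambda>B. \<Sum>m. \<Sum>n. if m = n then 0 else pair_moment Z B m n"
  have K2: "(\<integral>\<^sup>+\<omega>. (emeasure (kernel_image K \<Phi> \<omega>) B)\<^sup>2 \<partial>M) = ?P B + diagonal B"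
    if "B \<in> sets borel" for B
    using second_moment_kernel_image[OF ZM atoms that] by simp
  have L2: "(\<integral>\<^sup>+\<omega>. (emeasure (kernel_image L \<Phi> \<omega>) B)\<^sup>2 \<partial>M) = ?P B + L.diagonal B"
    if B: "B \<in> sets borel" for B
  proof -
    have "L.pair_moment Z B m n = pair_moment Z B m n" if "m \<noteq> n" for m n
      by (rule pair_moment_conditional[OF L Z B that ce, symmetric]) (use B in simp)
    then have "?P B = (\<Sum>m. \<Sum>n. if m = n then 0 else L.pair_moment Z B m n)"
      by (intro suminf_cong) auto
    then show ?thesis
      using L.second_moment_kernel_image[OF ZM atoms B] by simp
  qed
  show ?thesis
    using K2 L2 by (intro exI[of _ ?P] ballI conjI)
qed

text \<open>Both diagonals are finite on bounded sets, so either second moment is finite exactly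
  when \<open>P B\<close> is.\<close>

theorem locally_square_integrable_iff:
  assumes L: "stationary_transport M \<theta> \<Phi> Y X L"
    and cond: "cond_product_kernel M \<Phi> (transport L \<Phi>) K L"
  shows "locally_square_integrable M (kernel_image K \<Phi>) \<longleftrightarrow>
    locally_square_integrable M (kernel_image L \<Phi>)"
proof -
  interpret L: stationary_transport M \<theta> \<Phi> Y X L
    by fact
  obtain P where
    "\<And>B. B \<in> sets borel \<Longrightarrow> (\<integral>\<^sup>+\<omega>. (emeasure (kernel_image K \<Phi> \<omega>) B)\<^sup>2 \<partial>M) = P B + diagonal B"
    "\<And>B. B \<in> sets borel \<Longrightarrow> (\<integral>\<^sup>+\<omega>. (emeasure (kernel_image L \<Phi> \<omega>) B)\<^sup>2 \<partial>M) = P B + L.diagonal B"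
    using second_moments_conditional[OF L cond] by blast
  then show ?thesis
    using diagonal_finite L.diagonal_finite by (auto simp: locally_square_integrable_def)
qed

text \<open>In the difference \<open>P B\<close> and the squared means cancel. What remains are the
  two diagonals divided by the volume, and these have the same limit.\<close>

theorem normalized_variance_difference_tendsto_0:
  assumes L: "stationary_transport M \<theta> \<Phi> Y X L"
    and cond: "cond_product_kernel M \<Phi> (transport L \<Phi>) K L"
    and int_L: "locally_square_integrable M (kernel_image L \<Phi>)"
    and W: "W \<in> \<K>\<^sub>0"
  shows "((\<lambda>r. normalized_variance M (kernel_image K \<Phi>) W r
    - normalized_variance M (kernel_image L \<Phi>) W r) \<longlongrightarrow> 0) at_top"
proof -
  interpret L: stationary_transport M \<theta> \<Phi> Y X L
    by fact
  have int_K: "locally_square_integrable M (kernel_image K \<Phi>)"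
    using int_L locally_square_integrable_iff[OF L cond] by simp
  obtain P where
    K2: "\<And>B. B \<in> sets borel \<Longrightarrow> (\<integral>\<^sup>+\<omega>. (emeasure (kernel_image K \<Phi> \<omega>) B)\<^sup>2 \<partial>M) = P B + diagonal B" and
    L2: "\<And>B. B \<in> sets borel \<Longrightarrow> (\<integral>\<^sup>+\<omega>. (emeasure (kernel_image L \<Phi> \<omega>) B)\<^sup>2 \<partial>M) = P B + L.diagonal B"
    using second_moments_conditional[OF L cond] by blast
  show ?thesis
  proof (cases "W \<in> sets borel")
    case False
    have "\<forall>\<^sub>F r in at_top. 0 = normalized_variance M (kernel_image K \<Phi>) W r
        - normalized_variance M (kernel_image L \<Phi>) W r"
      using eventually_gt_at_top[of 0]
      by eventually_elim (simp add: normalized_variance_not_borel[OF False]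
          L.normalized_variance_not_borel[OF False])
    then show ?thesis
      by (rule Lim_transform_eventually[OF tendsto_const])
  next
    case True
    have convex: "convex W" and bounded: "bounded W" and interior: "interior W \<noteq> {}"
      using W by (auto simp: \<K>\<^sub>0_def)
    have "((\<lambda>r. enn2real (diagonal ((\<lambda>x. r *\<^sub>R x) ` W)) / measure lborel ((\<lambda>x. r *\<^sub>R x) ` W)
        - enn2real (L.diagonal ((\<lambda>x. r *\<^sub>R x) ` W)) / measure lborel ((\<lambda>x. r *\<^sub>R x) ` W)) \<longlongrightarrow> 0) at_top"
      using tendsto_diff[OF diagonal_asymptotics L.diagonal_asymptotics, OF True convex bounded interior
          True convex bounded interior]
      by simp
    then show ?thesis
    proof (rule Lim_transform_eventually)
      show "\<forall>\<^sub>F r in at_top. enn2real (diagonal ((\<lambda>x. r *\<^sub>R x) ` W)) / measure lborel ((\<lambda>x. r *\<^sub>R x) ` W)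
          - enn2real (L.diagonal ((\<lambda>x. r *\<^sub>R x) ` W)) / measure lborel ((\<lambda>x. r *\<^sub>R x) ` W)
        = normalized_variance M (kernel_image K \<Phi>) W r - normalized_variance M (kernel_image L \<Phi>) W r"
        using eventually_gt_at_top[of 0]
      proof eventually_elim
        case (elim r)
        let ?B = "(\<lambda>x. r *\<^sub>R x) ` W"
        have B: "?B \<in> sets borel" "bounded ?B"
          using True elim bounded by (auto intro: borel_scaleR_image bounded_scaling)
        \<comment> \<open>Finiteness of all summands makes \<open>enn2real\<close> additive, so the
          common term \<open>P\<close> can be cancelled.\<close>
        have fin: "P ?B + diagonal ?B < \<infinity>" "P ?B + L.diagonal ?B < \<infinity>"
          using int_K int_L B unfolding locally_square_integrable_def K2[symmetric, OF B(1)] L2[symmetric, OF B(1)]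
          by auto
        have "variance (\<lambda>\<omega>. measure (kernel_image K \<Phi> \<omega>) ?B)
            = enn2real (P ?B + diagonal ?B) - (enn2real (\<gamma> * emeasure lborel ?B))\<^sup>2"
          using variance_kernel_image[OF B] fin(1) by (simp add: K2[OF B(1)])
        moreover have "variance (\<lambda>\<omega>. measure (kernel_image L \<Phi> \<omega>) ?B)
            = enn2real (P ?B + L.diagonal ?B) - (enn2real (\<gamma> * emeasure lborel ?B))\<^sup>2"
          using L.variance_kernel_image[OF B] fin(2) by (simp add: L2[OF B(1)])
        ultimately show ?case
          using fin by (simp add: normalized_variance_def diff_divide_distrib[symmetric] enn2real_plus)
      qed
    qed
  qed
qed

end

theorem theorem4p1:
  fixes M :: "'w measure"
    and \<theta> :: "'a::euclidean_space \<Rightarrow> 'w \<Rightarrow> 'w"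
    and \<Phi> :: "'w \<Rightarrow> 'a measure"
    and K L :: "'w \<Rightarrow> 'a \<Rightarrow> 'a measure"
    and T :: "'w \<Rightarrow> ('a \<times> 'a) measure"
  assumes "stationary_flow M \<theta>"
    and "random_measure M \<Phi>" and "invariant_measure M \<theta> \<Phi>" and "purely_discrete M \<Phi>"
    and "0 < intensity M \<Phi>" and "intensity M \<Phi> < \<infinity>"
    and "probability_kernel M L" and "invariant_kernel M \<theta> L"
    and "T = transport L \<Phi>"
    and "probability_kernel M K" and "invariant_kernel M \<theta> K"
    and "cond_product_kernel M \<Phi> T K L"
    and "(\<integral>\<^sup>+\<omega>. emeasure (\<Phi> \<omega>) {0} \<partial>palm_measure M \<theta> \<Phi>) < \<infinity>"
  shows "(locally_square_integrable M (kernel_image K \<Phi>) \<longleftrightarrow>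
            locally_square_integrable M (kernel_image L \<Phi>)) \<and>
         (locally_square_integrable M (kernel_image L \<Phi>) \<longrightarrow>
            (\<forall>W\<in>\<K>\<^sub>0.
               (\<exists>l::ereal. ((\<lambda>r. ereal (normalized_variance M (kernel_image K \<Phi>) W r)) \<longlongrightarrow> l) at_top \<or>
                           ((\<lambda>r. ereal (normalized_variance M (kernel_image L \<Phi>) W r)) \<longlongrightarrow> l) at_top) \<longrightarrow>
               (\<exists>l::ereal. ((\<lambda>r. ereal (normalized_variance M (kernel_image K \<Phi>) W r)) \<longlongrightarrow> l) at_top \<and>
                           ((\<lambda>r. ereal (normalized_variance M (kernel_image L \<Phi>) W r)) \<longlongrightarrow> l) at_top)))"
proof -
  obtain Y :: "nat \<Rightarrow> 'w \<Rightarrow> real" and X :: "nat \<Rightarrow> 'w \<Rightarrow> 'a"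
    where YX: "\<forall>n. Y n \<in> borel_measurable M \<and> X n \<in> borel_measurable M"
      "\<forall>n. \<forall>\<omega>\<in>space M. 0 \<le> Y n \<omega>"
      "\<forall>\<omega>\<in>space M. \<forall>B\<in>sets borel.
         emeasure (\<Phi> \<omega>) B = (\<Sum>n. ennreal (Y n \<omega>) * indicator B (X n \<omega>))"
    using assms(4) unfolding purely_discrete_def by blast
  have masses: "stationary_point_masses M \<theta> \<Phi> Y X"
    using assms YX by (intro stationary_point_masses.intro stationary_point_masses_axioms.intro) auto
  interpret K: stationary_transport M \<theta> \<Phi> Y X K
    using assms masses
    by (intro stationary_transport.intro prob_kernel.intro stationary_transport_axioms.intro)
  have L: "stationary_transport M \<theta> \<Phi> Y X L"
    using assms masses
    by (intro stationary_transport.intro prob_kernel.intro stationary_transport_axioms.intro)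
  have cond: "cond_product_kernel M \<Phi> (transport L \<Phi>) K L"
    using assms(9,12) by simp
  show ?thesis
  proof (intro conjI impI ballI)
    show "locally_square_integrable M (kernel_image K \<Phi>) \<longleftrightarrow>
        locally_square_integrable M (kernel_image L \<Phi>)"
      by (rule K.locally_square_integrable_iff[OF L cond])
  next
    fix W :: "'a set"
    let ?k = "normalized_variance M (kernel_image K \<Phi>) W"
    let ?l = "normalized_variance M (kernel_image L \<Phi>) W"
    assume "locally_square_integrable M (kernel_image L \<Phi>)" "W \<in> \<K>\<^sub>0"
    then have kl: "((\<lambda>r. ?k r - ?l r) \<longlongrightarrow> 0) at_top"
      by (rule K.normalized_variance_difference_tendsto_0[OF L cond])
    \<comment> \<open>Either of the two limits may be the given one, so the null difference is
      needed with both signs.\<close>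
    from tendsto_minus[OF this] have lk: "((\<lambda>r. ?l r - ?k r) \<longlongrightarrow> 0) at_top"
      by simp
    assume "\<exists>l::ereal. ((\<lambda>r. ereal (?k r)) \<longlongrightarrow> l) at_top \<or> ((\<lambda>r. ereal (?l r)) \<longlongrightarrow> l) at_top"
    then show "\<exists>l::ereal. ((\<lambda>r. ereal (?k r)) \<longlongrightarrow> l) at_top \<and> ((\<lambda>r. ereal (?l r)) \<longlongrightarrow> l) at_top"
      using tendsto_ereal_add_null[OF _ kl] tendsto_ereal_add_null[OF _ lk] by blast
  qed
qed

end
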